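(* Let $z_1,z_2\in\mathbb{C}\setminus(-\infty,1]$ and $\lambda,\alpha\in\mathbb{C}^\ast$, such that $\Re(\lambda+2\alpha)>0$. Then $$D_\lambda^{\alpha}(z_1)D_\lambda^{\alpha}(z_2)=\frac{e^{i\pi\alpha}\Gamma(\lambda+2\alpha)(z_1z_2)^{\alpha-1}}{2^{\alpha}\Gamma(\lambda+1)[\Gamma(\alpha)]^2(z_1^2-1)^{\alpha-\frac12}(z_2^2-1)^{\alpha-\frac12}}\int_{z_1z_2+\sqrt{(z_1^2-1)(z_2^2-1)}}^\infty D_\lambda^{\alpha}(z_3)\left(\frac{z_1^2+z_2^2+z_3^2-1}{2z_1z_2}-z_3\right)^{\alpha-1}dz_3 .$$
   Context: $\mathbb{C}^\ast=\mathbb{C}\setminus\{0\}$. The Gegenbauer function of the second kind on $\mathbb{C}\setminus(-\infty,1]$ is $D_\lambda^\alpha(z)=\frac{e^{i\pi\alpha}\Gamma(\lambda+2\alpha)}{\Gamma(\alpha)(2z)^{\lambda+2\alpha}}\mathbf{F}\big(\frac{\lambda}{2}+\alpha,\frac{\lambda}{2}+\alpha+\frac12;\lambda+\alpha+1;\frac1{z^2}\big)$ for $|z|>1$, and elsewhere by analytic continuation, where $\mathbf{F}(a,b;c;z)=\sum_{n\ge0}\frac{(a)_n(b)_n}{\Gamma(c+n)}\frac{z^n}{n!}$ is the regularized Gauss hypergeometric function.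
   Formalization: Adds Re α > 0 and Re λ > −1, without which the integral generally diverges (e.g. λ=3, α=−1/2). Powers and roots are the branches analytic in z1, z2 and positive for z1, z2 > 1; the path is the ray z1z2 + t√((z1²−1)(z2²−1)), t ≥ 1, with D continued along it across the cut. *)

theory Defs
  imports "HOL-Analysis.Analysis"
begin

definition cut_plane :: "complex set" where
  "cut_plane = - (complex_of_real ` {..1})"

text \<open>The regularized Gauss series; \<open>rGamma\<close> is the entire function \<open>1 / Gamma\<close>.\<close>

definition reg_hyp2F1 :: "complex \<Rightarrow> complex \<Rightarrow> complex \<Rightarrow> complex \<Rightarrow> complex" where
  "reg_hyp2F1 a b c z =
     (\<Sum>n. pochhammer a n * pochhammer b n * rGamma (c + of_nat n) * z ^ n / fact n)"

text \<open>
  The holomorphic function on \<open>S\<close> that agrees with \<open>f\<close> on \<open>U\<close>. It is only used for \<open>S\<close> open and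
  connected and \<open>U\<close> a nonempty open subset of \<open>S\<close>, where there is at most one such function on \<open>S\<close>.
\<close>

definition analytic_continuation ::
    "complex set \<Rightarrow> complex set \<Rightarrow> (complex \<Rightarrow> complex) \<Rightarrow> complex \<Rightarrow> complex" where
  "analytic_continuation S U f = (SOME g. g holomorphic_on S \<and> (\<forall>z\<in>U. g z = f z))"

definition gegenbauer_D_series :: "complex \<Rightarrow> complex \<Rightarrow> complex \<Rightarrow> complex" where
  "gegenbauer_D_series lam \<alpha> z =
     exp (\<i> * of_real pi * \<alpha>) * Gamma (lam + 2 * \<alpha>) / (Gamma \<alpha> * (2 * z) powr (lam + 2 * \<alpha>)) *
     reg_hyp2F1 (lam / 2 + \<alpha>) (lam / 2 + \<alpha> + 1 / 2) (lam + \<alpha> + 1) (1 / z\<^sup>2)"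

definition gegenbauer_D :: "complex \<Rightarrow> complex \<Rightarrow> complex \<Rightarrow> complex" where
  "gegenbauer_D lam \<alpha> =
     analytic_continuation cut_plane {z \<in> cut_plane. norm z > 1} (gegenbauer_D_series lam \<alpha>)"

text \<open>
  For \<open>z1\<close>, \<open>z2\<close> in the cut plane the contour from \<open>z1 z2 + sqrt ((z1\<^sup>2 - 1) (z2\<^sup>2 - 1))\<close> to
  infinity may meet or cross the cut \<open>(-\<infinity>, -1]\<close> (take \<open>z1 = z2 = 2\<i>\<close>, where it is contained in it).
  So the integrand needs the continuation of the function beyond this cut. It is multivalued in \<open>z\<close>,
  but single-valued in \<open>w = log z\<close>: \<open>gegenbauer_D_log lam \<alpha> w\<close> is the value at \<open>z = exp w\<close> on the
  sheet determined by \<open>w\<close>, and the sheet \<open>\<bar>Im w\<bar> < pi\<close> is \<open>gegenbauer_D\<close> itself. The set of all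
  \<open>w\<close> with \<open>exp w \<notin> [-1, 1]\<close> is connected.
\<close>

definition gegenbauer_D_log :: "complex \<Rightarrow> complex \<Rightarrow> complex \<Rightarrow> complex" where
  "gegenbauer_D_log lam \<alpha> =
     analytic_continuation {w. exp w \<notin> complex_of_real ` {-1..1}}
       {w. \<bar>Im w\<bar> < pi \<and> exp w \<in> cut_plane} (\<lambda>w. gegenbauer_D lam \<alpha> (exp w))"

text \<open>
  All multivalued expressions take the branch that is analytic in \<open>z1\<close>, \<open>z2\<close> on the cut plane and
  is real for \<open>z1, z2 > 1\<close>. Principal values of \<open>log (z\<^sup>2 - 1)\<close> and \<open>log (z1 z2)\<close> would jump inside
  the cut plane, whereas \<open>Ln (z - 1) + Ln (z + 1)\<close> and \<open>Ln z1 + Ln z2\<close> do not.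
\<close>

definition ln_sq_minus_1 :: "complex \<Rightarrow> complex" where
  "ln_sq_minus_1 z = Ln (z - 1) + Ln (z + 1)"

text \<open>The logarithm of \<open>x\<close> whose imaginary part differs from that of \<open>r\<close> by at most \<open>pi\<close>.\<close>

definition ln_near :: "complex \<Rightarrow> complex \<Rightarrow> complex" where
  "ln_near r x = r + Ln (x / exp r)"

text \<open>
  The contour is the ray from \<open>z1 z2 + sqrt (z1\<^sup>2 - 1) sqrt (z2\<^sup>2 - 1)\<close> (at \<open>t = 1\<close>) to infinity on
  which the base of the power in the integrand keeps a constant argument.
\<close>

definition sqrt_prod :: "complex \<Rightarrow> complex \<Rightarrow> complex" where
  "sqrt_prod z1 z2 = exp ((ln_sq_minus_1 z1 + ln_sq_minus_1 z2) / 2)"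

definition contour_ray :: "complex \<Rightarrow> complex \<Rightarrow> real \<Rightarrow> complex" where
  "contour_ray z1 z2 t = z1 * z2 + of_real t * sqrt_prod z1 z2"

definition kernel_base :: "complex \<Rightarrow> complex \<Rightarrow> complex \<Rightarrow> complex" where
  "kernel_base z1 z2 z3 = (z1\<^sup>2 + z2\<^sup>2 + z3\<^sup>2 - 1) / (2 * z1 * z2) - z3"

text \<open>
  On the ray \<open>z3 / (z1 z2)\<close> avoids \<open>(-\<infinity>, 0]\<close>, and \<open>kernel_base z1 z2 z3\<close> is a positive multiple of
  \<open>(z1\<^sup>2 - 1) (z2\<^sup>2 - 1) / (z1 z2)\<close> (lemma \<open>kernel_base_contour_ray\<close>), so both logarithms below
  are continuous along the ray.
\<close>

definition ln_z3 :: "complex \<Rightarrow> complex \<Rightarrow> complex \<Rightarrow> complex" where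
  "ln_z3 z1 z2 z3 = ln_near (Ln z1 + Ln z2) z3"

definition ln_kernel_base :: "complex \<Rightarrow> complex \<Rightarrow> complex \<Rightarrow> complex" where
  "ln_kernel_base z1 z2 z3 =
     ln_near (ln_sq_minus_1 z1 + ln_sq_minus_1 z2 - Ln z1 - Ln z2) (kernel_base z1 z2 z3)"

text \<open>
  Along the ray the integrand is of order \<open>(t - 1) powr (Re \<alpha> - 1)\<close> at \<open>t = 1\<close> and
  \<open>t powr (- Re lam - 2)\<close> at infinity, so its integral converges for \<open>Re \<alpha> > 0\<close> and
  \<open>Re lam > -1\<close>. The factor \<open>sqrt_prod z1 z2\<close> that accompanies it is the derivative of the ray.
\<close>

definition product_integrand ::
    "complex \<Rightarrow> complex \<Rightarrow> complex \<Rightarrow> complex \<Rightarrow> complex \<Rightarrow> complex" where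
  "product_integrand lam \<alpha> z1 z2 z3 =
     gegenbauer_D_log lam \<alpha> (ln_z3 z1 z2 z3) * exp ((\<alpha> - 1) * ln_kernel_base z1 z2 z3)"

lemma exp_ln_near: "x \<noteq> 0 \<Longrightarrow> exp (ln_near r x) = x"
  by (simp add: ln_near_def exp_add)

lemma cut_plane_not_real:
  assumes "z \<in> cut_plane"
  shows "z \<noteq> 0" "z \<noteq> 1" "z \<noteq> -1"
proof -
  have "z \<noteq> complex_of_real r" if "r \<le> 1" for r
    using assms that by (auto simp: cut_plane_def)
  from this[of 0] this[of 1] this[of "-1"] show "z \<noteq> 0" "z \<noteq> 1" "z \<noteq> -1"
    by auto
qed

lemma exp_ln_sq_minus_1:
  assumes "z \<in> cut_plane"
  shows "exp (ln_sq_minus_1 z) = z\<^sup>2 - 1"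
proof -
  have "z - 1 \<noteq> 0" "z + 1 \<noteq> 0"
    using cut_plane_not_real[OF assms] by (auto simp: add_eq_0_iff2)
  then have "exp (ln_sq_minus_1 z) = (z - 1) * (z + 1)"
    by (simp add: ln_sq_minus_1_def exp_add)
  then show ?thesis
    by (simp add: power2_eq_square algebra_simps)
qed

lemma sqrt_prod_squared:
  assumes "z1 \<in> cut_plane" "z2 \<in> cut_plane"
  shows "(sqrt_prod z1 z2)\<^sup>2 = (z1\<^sup>2 - 1) * (z2\<^sup>2 - 1)"
proof -
  have "(sqrt_prod z1 z2)\<^sup>2 = exp (ln_sq_minus_1 z1 + ln_sq_minus_1 z2)"
    by (simp add: sqrt_prod_def power2_eq_square flip: exp_add)
  then show ?thesis
    using assms by (simp add: exp_add exp_ln_sq_minus_1)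
qed

lemma kernel_base_contour_ray:
  assumes "z1 \<in> cut_plane" "z2 \<in> cut_plane"
  shows "kernel_base z1 z2 (contour_ray z1 z2 t) =
           of_real ((t\<^sup>2 - 1) / 2) * ((z1\<^sup>2 - 1) * (z2\<^sup>2 - 1) / (z1 * z2))"
proof -
  have nz: "z1 \<noteq> 0" "z2 \<noteq> 0"
    using assms cut_plane_not_real by auto
  have "kernel_base z1 z2 (contour_ray z1 z2 t) =
          ((of_real t)\<^sup>2 * (sqrt_prod z1 z2)\<^sup>2 - (z1\<^sup>2 - 1) * (z2\<^sup>2 - 1)) / (2 * z1 * z2)"
    using nz by (simp add: kernel_base_def contour_ray_def field_simps power2_eq_square)
  also have "\<dots> = ((of_real t)\<^sup>2 - 1) * ((z1\<^sup>2 - 1) * (z2\<^sup>2 - 1)) / (2 * z1 * z2)"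
    unfolding sqrt_prod_squared[OF assms] by (simp add: algebra_simps)
  finally show ?thesis
    using nz by (simp add: field_simps)
qed

lemma ln_kernel_base_contour_ray:
  assumes "z1 \<in> cut_plane" "z2 \<in> cut_plane" "t > 1"
  shows "ln_kernel_base z1 z2 (contour_ray z1 z2 t) =
           ln_sq_minus_1 z1 + ln_sq_minus_1 z2 - Ln z1 - Ln z2 + of_real (ln ((t\<^sup>2 - 1) / 2))"
proof -
  have nz: "z1 \<noteq> 0" "z2 \<noteq> 0" "z1\<^sup>2 - 1 \<noteq> 0" "z2\<^sup>2 - 1 \<noteq> 0"
    using cut_plane_not_real[OF assms(1)] cut_plane_not_real[OF assms(2)]
    by (auto simp: power2_eq_1_iff)
  have pos: "(t\<^sup>2 - 1) / 2 > 0"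
    using assms(3) by simp
  have "exp (ln_sq_minus_1 z1 + ln_sq_minus_1 z2 - Ln z1 - Ln z2) =
          (z1\<^sup>2 - 1) * (z2\<^sup>2 - 1) / (z1 * z2)"
    using nz assms by (simp add: exp_add exp_diff exp_ln_sq_minus_1)
  then have "kernel_base z1 z2 (contour_ray z1 z2 t) /
               exp (ln_sq_minus_1 z1 + ln_sq_minus_1 z2 - Ln z1 - Ln z2) =
             of_real ((t\<^sup>2 - 1) / 2)"
    using nz unfolding kernel_base_contour_ray[OF assms(1,2)] by simp
  then show ?thesis
    unfolding ln_kernel_base_def ln_near_def by (simp only: Ln_of_real[OF pos])
qed

end

(* With p = sqrt (1 - 1/z^2) and nu = lam + 2 alpha, D(z) is a constant times z^(-nu) F(1/z^2), where
   F(1 - p^2) is the Laplace type integral of (1 + t p)^(-nu) (t^2 - 1)^(alpha - 1) over t > 1.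
   On the contour z3 = z1 z2 (1 + t p q), so the formula becomes
     int_1^oo (1 + t p q)^(-nu) F((1 - p^2) (1 - q^2) / (1 + t p q)^2) (t^2 - 1)^(alpha - 1) dt
       = F(1 - p^2) F(1 - q^2).
   The integrand satisfies a PDE in (p, t) whose t-part is the derivative of a boundary term, so for
   fixed q the left-hand side solves in x = 1 - p^2 the hypergeometric equation. The solutions
   analytic at x = 0 form a line, and at x = 0 the left-hand side is the Laplace integral of q.
   The same argument with q = 1 shows that the Laplace integral continues the Gauss series. *)
theory Submission
  imports Defs "HOL-Complex_Analysis.Complex_Analysis"
begin

section \<open>Parametric integrals\<close>

text \<open>The point \<open>x = 0\<close>, where the hypergeometric equation is singular,
  corresponds to \<open>p = 1\<close>, an interior point of the half-plane \<open>Re p > 0\<close>.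
  So whatever is holomorphic in \<open>p\<close> there is analytic at \<open>x = 0\<close> as a
  function of \<open>x\<close>, and a solution is identified by a single value, without connection
  formulas. The recurrence behind this never divides by zero, because
  \<open>Re (lam + \<alpha> + 1) > 0\<close>. The analytic obstacle is that the integrals run over a
  half-line, with a weight that may be singular at \<open>t = 1\<close> and only algebraic decay,
  and have to be differentiated twice. A locally uniform bound for the kernel alone suffices:
  Cauchy's estimate passes it on to the derivatives. The geometric obstacle is that the Gauss series
  converges only in the unit disc, whereas F is needed at arguments anywhere in the plane cut along
  the reals from 1 to infinity. These arguments have to be kept off the cut, and
  \<open>1 + t p q\<close> off the cut of the logarithm; both follow from the positive real parts of
  \<open>p\<close> and \<open>q\<close>.\<close>

definition dominated_on :: "complex set \<Rightarrow> real set \<Rightarrow> (complex \<Rightarrow> real \<Rightarrow> complex) \<Rightarrow> bool" where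
  "dominated_on S T g \<longleftrightarrow> open S \<and> (\<forall>t\<in>T. (\<lambda>z. g z t) holomorphic_on S) \<and> (\<forall>z\<in>S. g z integrable_on T) \<and>
     (\<forall>z0\<in>S. \<exists>r>0. \<exists>B. ball z0 r \<subseteq> S \<and> B integrable_on T \<and> (\<forall>z\<in>ball z0 r. \<forall>t\<in>T. norm (g z t) \<le> B t))"

text \<open>Cauchy's estimate on discs of radius \<open>r/3\<close> about points of the ball of
  radius \<open>r/2\<close>. These discs stay inside \<open>ball z0 r\<close> because
  \<open>r/2 + r/3 < r\<close>, and the bound is only multiplied by \<open>3/r\<close>.\<close>

lemma dominated_on_deriv_bound:
  assumes "dominated_on S T g" "z0 \<in> S"
  shows "\<exists>r>0. \<exists>B. ball z0 r \<subseteq> S \<and> B integrable_on T \<and>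
           (\<forall>z\<in>ball z0 r. \<forall>t\<in>T. norm (deriv (\<lambda>z. g z t) z) \<le> B t)"
proof -
  obtain r B where r: "r > 0" "ball z0 r \<subseteq> S" and B: "B integrable_on T"
    "\<And>z t. z \<in> ball z0 r \<Longrightarrow> t \<in> T \<Longrightarrow> norm (g z t) \<le> B t"
    using assms unfolding dominated_on_def by meson
  have "norm (deriv (\<lambda>z. g z t) z) \<le> B t * (3 / r)" if z: "z \<in> ball z0 (r/2)" and t: "t \<in> T" for z t
  proof -
    have sub: "cball z (r/3) \<subseteq> ball z0 r"
    proof
      fix y assume y: "y \<in> cball z (r/3)"
      have "dist z0 y \<le> dist z0 z + dist z y" by (rule dist_triangle)
      also have "\<dots> < r" using y z r by auto
      finally show "y \<in> ball z0 r" by simp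
    qed
    have hol: "(\<lambda>z. g z t) holomorphic_on ball z0 r"
      using assms t r unfolding dominated_on_def by (meson holomorphic_on_subset)
    have "norm ((deriv ^^ 1) (\<lambda>z. g z t) z) \<le> fact 1 * B t / (r/3) ^ 1"
    proof (rule Cauchy_inequality)
      show "(\<lambda>z. g z t) holomorphic_on ball z (r/3)"
        by (rule holomorphic_on_subset[OF hol]) (use sub ball_subset_cball in blast)
      show "continuous_on (cball z (r/3)) (\<lambda>z. g z t)"
        by (rule holomorphic_on_imp_continuous_on, rule holomorphic_on_subset[OF hol sub])
    next
      fix x assume "norm (z - x) = r / 3"
      then have "x \<in> cball z (r/3)" by (simp add: dist_norm)
      then show "norm (g x t) \<le> B t" using B t sub by blast
    qed (use r in auto)
    then show ?thesis by (simp add: mult_ac)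
  qed
  moreover have "(\<lambda>t. B t * (3/r)) integrable_on T"
    using B(1) by (rule integrable_on_mult_left)
  moreover have "ball z0 (r/2) \<subseteq> S" using r(2) subset_ball[of "r/2" r z0] r(1) by (auto simp del: subset_ball)
  ultimately show ?thesis using r by (intro exI[of _ "r/2"] conjI exI[of _ "\<lambda>t. B t * (3/r)"]) auto
qed

text \<open>The mean value inequality bounds the difference quotients by the bound for the
  derivative, so dominated convergence applies along every sequence tending to \<open>z0\<close>.
  The derivative is integrable as the limit in that theorem.\<close>

lemma dominated_on_integral_deriv:
  assumes dom: "dominated_on S T g" and z0: "z0 \<in> S"
  shows "(\<lambda>t. deriv (\<lambda>z. g z t) z0) integrable_on T" (is ?I)
    and "((\<lambda>z. integral T (g z)) has_field_derivative integral T (\<lambda>t. deriv (\<lambda>z. g z t) z0)) (at z0)" (is ?D)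
proof -
  obtain r B where r: "r > 0" "ball z0 r \<subseteq> S" and B: "B integrable_on T"
    "\<And>z t. z \<in> ball z0 r \<Longrightarrow> t \<in> T \<Longrightarrow> norm (deriv (\<lambda>z. g z t) z) \<le> B t"
    using dominated_on_deriv_bound[OF dom z0] by meson
  have int: "\<And>z. z \<in> S \<Longrightarrow> g z integrable_on T" using dom by (auto simp: dominated_on_def)
  have der: "((\<lambda>z. g z t) has_field_derivative deriv (\<lambda>z. g z t) z) (at z)" if "z \<in> ball z0 r" "t \<in> T" for z t
    using dom that r unfolding dominated_on_def by (meson holomorphic_derivI subsetD)
  have key: "?I \<and> (\<lambda>i. (integral T (g (X i)) - integral T (g z0)) / (X i - z0)) \<longlonglongrightarrow>
        integral T (\<lambda>t. deriv (\<lambda>z. g z t) z0)"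
    if X: "\<And>i. X i \<in> ball z0 r - {z0}" "X \<longlonglongrightarrow> z0" for X :: "nat \<Rightarrow> complex"
  proof -
    have XS: "X i \<in> S" for i using X r by blast
    have f: "(\<lambda>t. (g (X k) t - g z0 t) / (X k - z0)) integrable_on T" for k
      by (intro integrable_on_divide integrable_diff int XS z0)
    have le: "norm ((g (X k) t - g z0 t) / (X k - z0)) \<le> B t" if t: "t \<in> T" for k t
    proof -
      have "norm (g (X k) t - g z0 t) \<le> B t * norm (X k - z0)"
        by (rule field_differentiable_bound[of "ball z0 r" "\<lambda>z. g z t" "\<lambda>z. deriv (\<lambda>z. g z t) z"])
           (use der t B X r in \<open>auto intro: DERIV_subset has_field_derivative_at_within\<close>)
      moreover have "norm (X k - z0) > 0" using X(1)[of k] by auto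
      ultimately show ?thesis by (simp add: norm_divide divide_le_eq)
    qed
    have conv: "(\<lambda>k. (g (X k) t - g z0 t) / (X k - z0)) \<longlonglongrightarrow> deriv (\<lambda>z. g z t) z0" if t: "t \<in> T" for t
    proof -
      have "((\<lambda>y. (g y t - g z0 t) / (y - z0)) \<longlongrightarrow> deriv (\<lambda>z. g z t) z0) (at z0)"
        using der[OF _ t, of z0] r by (simp add: has_field_derivative_iff)
      then show ?thesis
        using X unfolding tendsto_at_iff_sequentially comp_def by blast
    qed
    have eq: "integral T (\<lambda>t. (g (X k) t - g z0 t) / (X k - z0)) =
        (integral T (g (X k)) - integral T (g z0)) / (X k - z0)" for k
      by (simp add: integral_diff int XS z0)
    show ?thesis
      using dominated_convergence[OF f B(1) le conv] unfolding eq by blast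
  qed
  have *: "((\<lambda>y. (integral T (g y) - integral T (g z0)) / (y - z0)) \<longlongrightarrow>
      integral T (\<lambda>t. deriv (\<lambda>z. g z t) z0)) (at z0 within ball z0 r)"
    unfolding tendsto_at_iff_sequentially comp_def using key by blast
  then show ?D
    using r by (simp add: has_field_derivative_iff at_within_open[of z0 "ball z0 r"])
  \<comment> \<open>\<open>key\<close> gives integrability of the derivative only in the presence of
    some admissible sequence.\<close>
  have "\<exists>X. (\<forall>i. X i \<in> ball z0 r - {z0}) \<and> X \<longlonglongrightarrow> z0"
  proof -
    have "z0 islimpt ball z0 r" using r by (simp add: islimpt_ball)
    then show ?thesis unfolding islimpt_sequential by blast
  qed
  then show ?I using key by blast
qed

text \<open>\<open>dominated_on\<close> asks for a bound on the integrand only and is inherited by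
  the derivative, so second derivatives under the integral sign need no further estimate.\<close>

lemma dominated_on_deriv:
  assumes dom: "dominated_on S T g"
  shows "dominated_on S T (\<lambda>z t. deriv (\<lambda>z. g z t) z)"
  unfolding dominated_on_def
proof (intro conjI ballI)
  show "open S" using dom by (simp add: dominated_on_def)
next
  fix t assume "t \<in> T"
  then show "(\<lambda>z. deriv (\<lambda>z. g z t) z) holomorphic_on S"
    using dom by (auto simp: dominated_on_def intro!: holomorphic_deriv)
qed (use dominated_on_integral_deriv(1)[OF dom] dominated_on_deriv_bound[OF dom] in auto)

lemma dominated_on_integral_holomorphic:
  assumes dom: "dominated_on S T g"
  shows "(\<lambda>z. integral T (g z)) holomorphic_on S"
  using dominated_on_integral_deriv(2)[OF dom] dom
  by (auto simp: dominated_on_def holomorphic_on_open)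

lemma continuous_dominated_integrable:
  fixes f :: "real \<Rightarrow> complex"
  assumes "open T" "continuous_on T f" "B integrable_on T" "\<And>t. t \<in> T \<Longrightarrow> norm (f t) \<le> B t"
  shows "f integrable_on T" "f absolutely_integrable_on T"
proof -
  have m: "f \<in> borel_measurable (lebesgue_on T)"
    using assms by (intro continuous_imp_measurable_on_sets_lebesgue) auto
  show "f integrable_on T"
    by (rule measurable_bounded_by_integrable_imp_integrable[OF m assms(3,4)]) (use assms in auto)
  show "f absolutely_integrable_on T"
    by (rule measurable_bounded_by_integrable_imp_absolutely_integrable[OF m _ assms(3,4)]) (use assms in auto)
qed

section \<open>The complex Beta integral\<close>

text \<open>Identity theorem: the positive reals accumulate at the interior point 1. This carries
  integral formulas from real to complex parameters.\<close>

lemma halfplane_eq_of_eq_on_reals: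
  assumes "f holomorphic_on {z. Re z > 0}" "g holomorphic_on {z. Re z > 0}"
    and "\<And>x::real. x > 0 \<Longrightarrow> f (of_real x) = g (of_real x)" and "Re z > 0"
  shows "f z = g z"
proof -
  have lim: "1 islimpt (complex_of_real ` {0<..})"
    unfolding islimpt_approachable
  proof (intro allI impI)
    fix e :: real assume "e > 0"
    moreover have "dist (complex_of_real (1 + e/2)) 1 = \<bar>e/2\<bar>"
      by (simp add: dist_norm)
    ultimately show "\<exists>x'\<in>complex_of_real ` {0<..}. x' \<noteq> 1 \<and> dist x' 1 < e"
      by (intro bexI[of _ "complex_of_real (1 + e/2)"] imageI) auto
  qed
  have "f z - g z = 0"
    by (rule analytic_continuation[of "\<lambda>z. f z - g z" "{z. Re z > 0}" "complex_of_real ` {0<..}" 1])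
       (use assms lim in \<open>auto intro!: holomorphic_intros simp: open_halfspace_Re_gt
          intro!: convex_connected convex_halfspace_Re_gt\<close>)
  then show ?thesis by simp
qed

definition beta_integrand :: "complex \<Rightarrow> complex \<Rightarrow> real \<Rightarrow> complex" where
  "beta_integrand a b t = of_real t powr (a - 1) * of_real (1 - t) powr (b - 1)"

lemma norm_beta_integrand:
  "t \<in> {0<..<1} \<Longrightarrow> norm (beta_integrand a b t) = t powr (Re a - 1) * (1 - t) powr (Re b - 1)"
  unfolding beta_integrand_def norm_mult
  by (subst norm_powr_real_powr norm_powr_real_powr, auto simp del: of_real_diff)+

lemma real_beta_integrable:
  assumes "a > 0" "b > (0::real)"
  shows "(\<lambda>t. t powr (a - 1) * (1 - t) powr (b - 1)) integrable_on {0<..<1}"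
  using has_integral_integrable[OF has_integral_Beta_real[OF assms]] integrable_on_open_interval_real by blast

lemma beta_integrand_integrable:
  assumes "Re a > 0" "Re b > 0"
  shows "beta_integrand a b integrable_on {0<..<1}" "beta_integrand a b absolutely_integrable_on {0<..<1}"
proof -
  have c: "continuous_on {0<..<1} (beta_integrand a b)"
    unfolding beta_integrand_def by (intro continuous_intros) auto
  show "beta_integrand a b integrable_on {0<..<1}" "beta_integrand a b absolutely_integrable_on {0<..<1}"
    using continuous_dominated_integrable[OF _ c real_beta_integrable[OF assms]]
    by (auto simp: norm_beta_integrand)
qed

lemma beta_integrand_commute:
  assumes "Re a > 0" "Re b > 0"
  shows "integral {0<..<1} (beta_integrand a b) = integral {0<..<1} (beta_integrand b a)"
proof -
  have img: "(\<lambda>t::real. 1 - t) ` {0<..<1} = {0<..<1}"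
    by (auto simp: image_iff intro!: bexI[of _ "1 - _"])
  have "(\<lambda>t. \<bar>- 1\<bar> *\<^sub>R beta_integrand a b (1 - t)) absolutely_integrable_on {0<..<1} \<and>
      integral {0<..<1} (\<lambda>t. \<bar>- 1\<bar> *\<^sub>R beta_integrand a b (1 - t)) = integral ((\<lambda>t. 1 - t) ` {0<..<1}) (beta_integrand a b)"
    by (subst has_absolute_integral_change_of_variables_real)
       (use assms beta_integrand_integrable in \<open>auto simp: img intro!: derivative_eq_intros inj_onI\<close>)
  then show ?thesis
    unfolding img by (simp add: beta_integrand_def[abs_def] mult.commute)
qed

text \<open>Lowering the exponent of \<open>t\<close> increases the power on the unit interval, so
  the exponent \<open>Re a / 2 - 1\<close> serves for all parameters within distance
  \<open>Re a / 2\<close> of \<open>a\<close>.\<close>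

lemma beta_integrand_dominated:
  assumes b: "Re b > 0"
  shows "dominated_on {a. Re a > 0} {0<..<1} (\<lambda>a. beta_integrand a b)"
  unfolding dominated_on_def
proof (intro conjI ballI)
  fix t :: real assume "t \<in> {0<..<1}"
  then show "(\<lambda>a. beta_integrand a b t) holomorphic_on {a. 0 < Re a}"
    unfolding beta_integrand_def by (intro holomorphic_intros) auto
next
  fix a :: complex assume a: "a \<in> {a. 0 < Re a}"
  show "\<exists>r>0. \<exists>B. ball a r \<subseteq> {a. 0 < Re a} \<and> B integrable_on {0<..<1} \<and>
      (\<forall>z\<in>ball a r. \<forall>t\<in>{0<..<1}. norm (beta_integrand z b t) \<le> B t)"
  proof (intro exI[of _ "Re a / 2"] exI[of _ "\<lambda>t. t powr (Re a / 2 - 1) * (1 - t) powr (Re b - 1)"] conjI ballI)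
    have *: "Re z > Re a / 2" if "z \<in> ball a (Re a / 2)" for z
      using that abs_Re_le_cmod[of "a - z"] by (auto simp: dist_norm)
    show "ball a (Re a / 2) \<subseteq> {a. 0 < Re a}" using * a by force
    fix z and t :: real assume zt: "z \<in> ball a (Re a / 2)" "t \<in> {0<..<1}"
    have "t powr (Re z - 1) \<le> t powr (Re a / 2 - 1)"
      by (rule powr_mono') (use zt *[of z] in auto)
    then show "norm (beta_integrand z b t) \<le> t powr (Re a / 2 - 1) * (1 - t) powr (Re b - 1)"
      using zt by (simp add: norm_beta_integrand mult_right_mono)
  qed (use a b real_beta_integrable in auto)
qed (use b beta_integrand_integrable in \<open>auto simp: open_halfspace_Re_gt\<close>)

text \<open>The real formula is continued twice: in the first parameter while the second is real,
  and then in the other one, after the reflection of \<open>t\<close> in \<open>1/2\<close> has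
  exchanged the two.\<close>

theorem integral_Beta_complex:
  assumes "Re a > 0" "Re b > 0"
  shows "integral {0<..<1} (beta_integrand a b) = Beta a b"
proof -
  have hol: "(\<lambda>a. Beta a b) holomorphic_on {a. Re a > 0}" if "Re b > 0" for b :: complex
    unfolding Beta_altdef by (intro holomorphic_intros) (auto elim!: nonpos_Ints_cases)
  have hol': "(\<lambda>a. integral {0<..<1} (beta_integrand a b)) holomorphic_on {a. Re a > 0}" if "Re b > 0" for b
    by (rule dominated_on_integral_holomorphic[OF beta_integrand_dominated[OF that]])
  have 1: "integral {0<..<1} (beta_integrand (of_real x) (of_real y)) = Beta (of_real x) (of_real y)"
    if "x > 0" "y > 0" for x y :: real
  proof -
    have "((\<lambda>t. complex_of_real (t powr (x - 1) * (1 - t) powr (y - 1))) has_integral of_real (Beta x y)) {0<..<1}"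
      using has_integral_linear[OF has_integral_Beta_real[OF that] bounded_linear_of_real]
      by (simp only: o_def has_integral_Icc_iff_Ioo[symmetric])
    moreover have "Beta (complex_of_real x) (of_real y) = of_real (Beta x y)"
      using that by (simp add: Beta_def Gamma_complex_of_real flip: of_real_add)
    ultimately have "((\<lambda>t. complex_of_real (t powr (x - 1) * (1 - t) powr (y - 1))) has_integral Beta (of_real x) (of_real y)) {0<..<1}"
      by simp
    then have "(beta_integrand (of_real x) (of_real y) has_integral Beta (of_real x) (of_real y)) {0<..<1}"
    proof (rule has_integral_eq[rotated])
      fix t :: real assume t: "t \<in> {0<..<1}"
      then show "complex_of_real (t powr (x - 1) * (1 - t) powr (y - 1)) = beta_integrand (of_real x) (of_real y) t"
        using powr_of_real[of t "x - 1"] powr_of_real[of "1 - t" "y - 1"] by (simp add: beta_integrand_def)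
    qed
    then show ?thesis by (rule integral_unique)
  qed
  have 2: "integral {0<..<1} (beta_integrand z (of_real y)) = Beta z (of_real y)"
    if "y > 0" "Re z > 0" for z and y :: real
    by (rule halfplane_eq_of_eq_on_reals[OF hol' hol _ that(2)]) (use that 1 in auto)
  show ?thesis
  proof -
    have "integral {0<..<1} (beta_integrand b a) = Beta b a"
      by (rule halfplane_eq_of_eq_on_reals[OF hol' hol _ assms(2)])
         (use assms 2 in \<open>auto simp: beta_integrand_commute[of _ a] Beta_commute[of _ a]\<close>)
    then show ?thesis using assms by (simp add: beta_integrand_commute[of a] Beta_commute[of a])
  qed
qed

text \<open>Up to the factor \<open>2 powr (1 - \<alpha>)\<close>, the \<open>t\<close>-dependent
  part of the power of \<open>kernel_base\<close> along the contour.\<close>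

definition weight :: "complex \<Rightarrow> real \<Rightarrow> complex" where
  "weight \<alpha> t = of_real (t\<^sup>2 - 1) powr (\<alpha> - 1)"

text \<open>The substitution \<open>s = 2 / (1 + t)\<close> turns \<open>t^2 - 1\<close> into
  \<open>4 (1 - s) / s^2\<close> and the integral into a Beta integral. A multiple of the norm of
  the integrand dominates the kernels below, and the value of the integral is that of
  \<open>hyp_cont\<close> at 0.\<close>

lemma integral_algebraic_weight:
  assumes "Re \<alpha> > 0" "Re lam > -1"
  defines "f \<equiv> \<lambda>t. of_real (1 + t) powr (-(lam + 2 * \<alpha>)) * weight \<alpha> t"
  shows "f absolutely_integrable_on {1<..}" "integral {1<..} f = 2 powr (-lam - 1) * Beta (lam + 1) \<alpha>"
proof -
  define g where "g = (\<lambda>s::real. 2 / s - 1)"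
  have inj: "inj_on g {0<..<1}" by (auto simp: inj_on_def g_def)
  have der: "(g has_field_derivative - 2 / s\<^sup>2) (at s within {0<..<1})" if "s \<in> {0<..<1}" for s
    using that unfolding g_def by (auto intro!: derivative_eq_intros simp: power2_eq_square)
  have img: "g ` {0<..<1} = {1<..}"
  proof (intro equalityI subsetI)
    fix t :: real assume t: "t \<in> {1<..}"
    have "t = g (2 / (1 + t))" "2 / (1 + t) \<in> {0<..<1}" using t by (auto simp: g_def field_simps)
    then show "t \<in> g ` {0<..<1}" by blast
  qed (auto simp: g_def field_simps)
  have eq: "\<bar>- 2 / s\<^sup>2\<bar> *\<^sub>R f (g s) = 2 powr (-lam - 1) * beta_integrand (lam + 1) \<alpha> s" if s: "s \<in> {0<..<1}" for s
  proof -
    have a: "1 + g s = 2 / s" "(g s)\<^sup>2 - 1 = 2 * 2 * (1 - s) / (s * s)"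
      using s by (auto simp: g_def field_simps power2_eq_square)
    have l: "ln (2 * 2 * (1 - s) / (s * s)) = ln 2 + ln 2 + ln (1 - s) - (ln s + ln s)"
    proof -
      have "ln (2 * 2 * (1 - s) / (s * s)) = ln (2 * 2 * (1 - s)) - ln (s * s)"
        by (rule ln_divide_pos) (use s in auto)
      moreover have "ln (2 * 2 * (1 - s)) = ln (2 * 2) + ln (1 - s)" by (rule ln_mult_pos) (use s in auto)
      moreover have "ln (2 * 2::real) = ln 2 + ln 2" by (rule ln_mult_pos) auto
      moreover have "ln (s * s) = ln s + ln s" by (rule ln_mult_pos) (use s in auto)
      ultimately show ?thesis by simp
    qed
    have p: "complex_of_real x powr w = exp (w * of_real (ln x))" if "x > 0" for x w
      using that by (simp add: powr_def Ln_of_real)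
    have "f (g s) = exp (-(lam + 2 * \<alpha>) * of_real (ln 2 - ln s)) *
        exp ((\<alpha> - 1) * of_real (ln 2 + ln 2 + ln (1 - s) - (ln s + ln s)))"
      using s unfolding f_def weight_def a by (subst p p, simp)+ (simp only: l, simp add: ln_div)
    moreover have "complex_of_real \<bar>- 2 / s\<^sup>2\<bar> = exp (of_real (ln 2 - 2 * ln s))"
      using s by (simp add: exp_of_real exp_diff exp_double del: of_real_diff)
    moreover have "2 powr (-lam - 1) * beta_integrand (lam + 1) \<alpha> s =
        exp ((-lam - 1) * of_real (ln 2)) * (exp (lam * of_real (ln s)) * exp ((\<alpha> - 1) * of_real (ln (1 - s))))"
      using s p[of s lam] p[of "1 - s" "\<alpha> - 1"] p[of 2 "-lam - 1"] by (simp add: beta_integrand_def)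
    ultimately show ?thesis
      unfolding scaleR_conv_of_real by (simp only: flip: exp_add) (simp add: algebra_simps)
  qed
  have abs: "(\<lambda>s. \<bar>- 2 / s\<^sup>2\<bar> *\<^sub>R f (g s)) absolutely_integrable_on {0<..<1}"
  proof -
    have "(\<lambda>s. 2 powr (-lam - 1) * beta_integrand (lam + 1) \<alpha> s) absolutely_integrable_on {0<..<1}"
      by (intro set_integrable_mult_right beta_integrand_integrable) (use assms in auto)
    then show ?thesis by (rule set_integrable_cong[THEN iffD1, rotated -1]) (simp_all only: eq)
  qed
  show fa: "f absolutely_integrable_on {1<..}"
    using absolutely_integrable_change_of_variables_real[OF _ der inj, of f] abs img by simp
  have "integral {1<..} f = integral {0<..<1} (\<lambda>s. \<bar>- 2 / s\<^sup>2\<bar> *\<^sub>R f (g s))"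
    using has_absolute_integral_change_of_variables_real[OF _ der inj, of f "integral {1<..} f"] fa
    unfolding img by simp
  also have "\<dots> = 2 powr (-lam - 1) * Beta (lam + 1) \<alpha>"
    using integral_Beta_complex[of "lam + 1" \<alpha>] assms
    by (subst integral_cong[OF eq]) (auto)
  finally show "integral {1<..} f = 2 powr (-lam - 1) * Beta (lam + 1) \<alpha>" .
qed

section \<open>The hypergeometric differential equation\<close>

lemma hypergeometric_ode_recurrence:
  fixes f :: "complex \<Rightarrow> complex"
  assumes hol: "f holomorphic_on ball 0 1"
    and ode: "\<And>x. x \<in> ball 0 1 \<Longrightarrow>
      x * (1 - x) * deriv (deriv f) x + (c - (a + b + 1) * x) * deriv f x - a * b * f x = 0"
  defines "F \<equiv> fps_expansion f 0"
  shows "(of_nat n + 1) * (c + of_nat n) * fps_nth F (Suc n) = (a + of_nat n) * (b + of_nat n) * fps_nth F n"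
proof -
  have F: "f has_fps_expansion F"
    unfolding F_def by (rule has_fps_expansion_fps_expansion[OF _ _ hol]) auto
  have "(\<lambda>x. x * (1 - x) * deriv (deriv f) x + (c - (a + b + 1) * x) * deriv f x - a * b * f x)
      has_fps_expansion fps_X * (1 - fps_X) * fps_deriv (fps_deriv F) +
        (fps_const c - fps_const (a + b + 1) * fps_X) * fps_deriv F - fps_const (a * b) * F" (is "?L has_fps_expansion ?R")
    by (intro fps_expansion_intros F)
  moreover have "?L has_fps_expansion 0"
  proof -
    have "eventually (\<lambda>x::complex. x \<in> ball 0 1) (nhds 0)" by (intro eventually_nhds_in_open) auto
    then have "eventually (\<lambda>x. ?L x = 0) (nhds 0)" by eventually_elim (use ode in auto)
    then show ?thesis by (subst has_fps_expansion_cong) auto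
  qed
  ultimately have "?R = 0" by (rule fps_expansion_unique_complex)
  moreover have "?R = fps_X * fps_deriv (fps_deriv F) - fps_X * (fps_X * fps_deriv (fps_deriv F)) +
      fps_const c * fps_deriv F - fps_const (a + b + 1) * (fps_X * fps_deriv F) - fps_const (a * b) * F" (is "_ = ?R'")
    by (simp only: algebra_simps mult_1_left)
  ultimately have "fps_nth ?R' n = 0" by simp
  \<comment> \<open>\<open>fps_X\<close> shifts the index up to two times, which makes
    \<open>n = 0\<close> and \<open>n = 1\<close> separate cases.\<close>
  then show ?thesis
    by (cases n; cases "n - 1")
       (simp_all only: fps_sub_nth fps_add_nth fps_X_mult_nth fps_mult_left_const_nth fps_deriv_nth, simp_all add: algebra_simps)
qed

text \<open>As \<open>c + n\<close> never vanishes, the recurrence determines all Taylor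
  coefficients from \<open>f 0\<close>. Multiplied by \<open>rGamma c\<close> they become those of
  the regularized series, because
  \<open>rGamma (c + n) = (c + n) * rGamma (c + n + 1)\<close>.\<close>

lemma hypergeometric_ode_solution:
  fixes f :: "complex \<Rightarrow> complex"
  assumes hol: "f holomorphic_on ball 0 1"
    and ode: "\<And>x. x \<in> ball 0 1 \<Longrightarrow>
      x * (1 - x) * deriv (deriv f) x + (c - (a + b + 1) * x) * deriv f x - a * b * f x = 0"
    and c: "c \<notin> \<int>\<^sub>\<le>\<^sub>0" and x: "x \<in> ball 0 1"
  shows "rGamma c * f x = f 0 * reg_hyp2F1 a b c x"
proof -
  define F where "F = fps_expansion f 0"
  have cn: "c + of_nat n \<noteq> 0" for n
  proof
    assume "c + of_nat n = 0"
    then have "c = - of_nat n" by (simp add: add_eq_0_iff)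
    with c show False by auto
  qed
  have coeff: "rGamma c * fps_nth F n = f 0 * (pochhammer a n * pochhammer b n * rGamma (c + of_nat n) / fact n)" for n
  proof (induction n)
    case 0
    then show ?case by (simp add: F_def fps_expansion_def)
  next
    case (Suc n)
    have r: "rGamma (c + of_nat n) = (c + of_nat n) * rGamma (c + of_nat (Suc n))"
      using rGamma_plus1[of "c + of_nat n"] by (simp add: algebra_simps)
    have n1: "(of_nat n + 1 :: complex) \<noteq> 0" by (metis of_nat_Suc of_nat_eq_0_iff add.commute nat.distinct(1))
    have "(of_nat n + 1) * (c + of_nat n) * (rGamma c * fps_nth F (Suc n)) =
        (a + of_nat n) * (b + of_nat n) * (rGamma c * fps_nth F n)"
      using hypergeometric_ode_recurrence[OF hol ode, of n] unfolding F_def by (simp add: mult_ac)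
    also have "\<dots> = (of_nat n + 1) * (c + of_nat n) *
        (f 0 * (pochhammer a (Suc n) * pochhammer b (Suc n) * rGamma (c + of_nat (Suc n)) / fact (Suc n)))"
    proof -
      have "u * v * (w * (P * Q * (d * R) / G)) = m * d * (w * (P * u * (Q * v) * R / (m * G)))"
        if "m \<noteq> 0" for u v w P Q d R m G :: complex
        using that by simp
      from this[OF n1] show ?thesis
        unfolding Suc.IH r pochhammer_Suc fact_Suc of_nat_mult of_nat_Suc by (simp only: add.commute[of 1])
    qed
    finally show ?case using n1 cn[of n] by (simp only: mult_left_cancel[OF no_zero_divisors] simp_thms)
  qed
  have "(\<lambda>n. (deriv ^^ n) f 0 / fact n * (x - 0) ^ n) sums f x"
    by (rule holomorphic_power_series[OF hol x])
  then have "(\<lambda>n. fps_nth F n * x ^ n) sums f x" by (simp add: F_def fps_expansion_def)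
  then have "(\<lambda>n. rGamma c * (fps_nth F n * x ^ n)) sums (rGamma c * f x)" by (rule sums_mult)
  moreover have "rGamma c * (fps_nth F n * x ^ n) =
      f 0 * (pochhammer a n * pochhammer b n * rGamma (c + of_nat n) * x ^ n / fact n)" for n
    using arg_cong[OF coeff[of n], of "\<lambda>y. y * x ^ n"] by (simp add: mult_ac)
  ultimately have S: "(\<lambda>n. f 0 * (pochhammer a n * pochhammer b n * rGamma (c + of_nat n) * x ^ n / fact n)) sums (rGamma c * f x)"
    by simp
  \<comment> \<open>\<open>reg_hyp2F1\<close> is a \<open>suminf\<close>, whose convergence is read
    off the Taylor series by dividing by \<open>f 0\<close>. For \<open>f 0 = 0\<close> the
    right-hand side is 0 whatever the \<open>suminf\<close> is.\<close>
  show ?thesis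
  proof (cases "f 0 = 0")
    case True
    then show ?thesis using sums_unique2[OF S[unfolded True mult_zero_left] sums_zero] by simp
  next
    case False
    with S have "(\<lambda>n. pochhammer a n * pochhammer b n * rGamma (c + of_nat n) * x ^ n / fact n) sums (rGamma c * f x / f 0)"
      by (rule sums_mult_D)
    then show ?thesis using False by (simp add: reg_hyp2F1_def sums_unique[symmetric])
  qed
qed

section \<open>The kernel and its differential equation\<close>

text \<open>With \<open>z3 = z1 z2 (1 + \<tau> p q)\<close>, where \<open>p\<^sup>2 = 1 - 1 / z1\<^sup>2\<close> and \<open>q\<^sup>2 = 1 - 1 / z2\<^sup>2\<close>, the
  argument of \<open>f\<close> is \<open>1 / z3\<^sup>2\<close>, and the whole kernel is a function of \<open>z3\<close> times a power of \<open>z1 z2\<close>.\<close>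

definition nu_kernel :: "complex \<Rightarrow> (complex \<Rightarrow> complex) \<Rightarrow> complex \<Rightarrow> complex \<Rightarrow> complex \<Rightarrow> complex" where
  "nu_kernel \<mu> f q p \<tau> = exp (- \<mu> * Ln (1 + \<tau> * p * q)) * f ((1 - p\<^sup>2) * (1 - q\<^sup>2) / (1 + \<tau> * p * q)\<^sup>2)"

text \<open>The chain rule is written with the kernel of \<open>deriv f\<close>, so that the next
  derivative is another instance of the same rule and the same growth bound applies to every
  term.\<close>

definition nu_kernel_p :: "complex \<Rightarrow> (complex \<Rightarrow> complex) \<Rightarrow> complex \<Rightarrow> complex \<Rightarrow> complex \<Rightarrow> complex" where
  "nu_kernel_p \<mu> f q p \<tau> =
     - \<mu> * \<tau> * q / (1 + \<tau> * p * q) * nu_kernel \<mu> f q p \<tau>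
     - 2 * (1 - q\<^sup>2) * (p + \<tau> * q) / (1 + \<tau> * p * q) ^ 3 * nu_kernel \<mu> (deriv f) q p \<tau>"

definition nu_kernel_t :: "complex \<Rightarrow> (complex \<Rightarrow> complex) \<Rightarrow> complex \<Rightarrow> complex \<Rightarrow> complex \<Rightarrow> complex" where
  "nu_kernel_t \<mu> f q p \<tau> =
     - \<mu> * p * q / (1 + \<tau> * p * q) * nu_kernel \<mu> f q p \<tau>
     - 2 * (1 - q\<^sup>2) * (1 - p\<^sup>2) * p * q / (1 + \<tau> * p * q) ^ 3 * nu_kernel \<mu> (deriv f) q p \<tau>"

lemma nu_kernel_deriv_p:
  assumes "open W" "f holomorphic_on W" "(1 - p\<^sup>2) * (1 - q\<^sup>2) / (1 + \<tau> * p * q)\<^sup>2 \<in> W"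
    and N: "1 + \<tau> * p * q \<notin> \<real>\<^sub>\<le>\<^sub>0"
  shows "((\<lambda>p. nu_kernel \<mu> f q p \<tau>) has_field_derivative nu_kernel_p \<mu> f q p \<tau>) (at p)"
proof -
  have N0: "1 + \<tau> * p * q \<noteq> 0" using N by auto
  have f: "(f has_field_derivative deriv f ((1 - p\<^sup>2) * (1 - q\<^sup>2) / (1 + \<tau> * p * q)\<^sup>2))
      (at ((1 - p\<^sup>2) * (1 - q\<^sup>2) / (1 + \<tau> * p * q)\<^sup>2))"
    by (rule holomorphic_derivI[OF assms(2,1,3)])
  have u: "((\<lambda>p. (1 - p\<^sup>2) * (1 - q\<^sup>2) / (1 + \<tau> * p * q)\<^sup>2) has_field_derivative
      - 2 * (1 - q\<^sup>2) * (p + \<tau> * q) / (1 + \<tau> * p * q) ^ 3) (at p)"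
  proof (rule DERIV_cong)
    define N where "N = 1 + \<tau> * p * q"
    show "((\<lambda>p. (1 - p\<^sup>2) * (1 - q\<^sup>2) / (1 + \<tau> * p * q)\<^sup>2) has_field_derivative
      (- (2 * p) * (1 - q\<^sup>2) * N\<^sup>2 - (1 - p\<^sup>2) * (1 - q\<^sup>2) * (2 * N * (\<tau> * q))) / (N\<^sup>2 * N\<^sup>2)) (at p)"
      unfolding N_def by (auto intro!: derivative_eq_intros simp: N0)
    \<comment> \<open>One factor \<open>N\<close> cancels, and the numerator simplifies by
      \<open>p * N + (1 - p^2) * \<tau> * q = p + \<tau> * q\<close>.\<close>
    have "(- (2 * p) * (1 - q\<^sup>2) * N\<^sup>2 - (1 - p\<^sup>2) * (1 - q\<^sup>2) * (2 * N * (\<tau> * q))) * N ^ 3 =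
        (- 2 * (1 - q\<^sup>2) * (p + \<tau> * q)) * (N\<^sup>2 * N\<^sup>2)"
      unfolding N_def by algebra
    then show "(- (2 * p) * (1 - q\<^sup>2) * N\<^sup>2 - (1 - p\<^sup>2) * (1 - q\<^sup>2) * (2 * N * (\<tau> * q))) / (N\<^sup>2 * N\<^sup>2) =
        - 2 * (1 - q\<^sup>2) * (p + \<tau> * q) / (1 + \<tau> * p * q) ^ 3"
      using N0 unfolding N_def[symmetric] by (simp add: frac_eq_eq)
  qed
  have E: "((\<lambda>p. exp (- \<mu> * Ln (1 + \<tau> * p * q))) has_field_derivative
      exp (- \<mu> * Ln (1 + \<tau> * p * q)) * (- \<mu> * \<tau> * q / (1 + \<tau> * p * q))) (at p)"
    using N by (auto intro!: derivative_eq_intros simp: N divide_simps)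
  have gen: "E * a * F + F' * (- 2 * b * c / d) * E = a * (E * F) - 2 * b * c / d * (E * F')" for E a F F' b c d :: complex
    by (simp add: algebra_simps)
  show ?thesis
    unfolding nu_kernel_def nu_kernel_p_def
    by (rule DERIV_cong[OF DERIV_mult[OF E DERIV_chain2[OF f u]]]) (rule gen)
qed

lemma nu_kernel_deriv_t:
  assumes "open W" "f holomorphic_on W" "(1 - p\<^sup>2) * (1 - q\<^sup>2) / (1 + \<tau> * p * q)\<^sup>2 \<in> W"
    and N: "1 + \<tau> * p * q \<notin> \<real>\<^sub>\<le>\<^sub>0"
  shows "((\<lambda>\<tau>. nu_kernel \<mu> f q p \<tau>) has_field_derivative nu_kernel_t \<mu> f q p \<tau>) (at \<tau>)"
proof -
  have N0: "1 + \<tau> * p * q \<noteq> 0" using N by auto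
  have f: "(f has_field_derivative deriv f ((1 - p\<^sup>2) * (1 - q\<^sup>2) / (1 + \<tau> * p * q)\<^sup>2))
      (at ((1 - p\<^sup>2) * (1 - q\<^sup>2) / (1 + \<tau> * p * q)\<^sup>2))"
    by (rule holomorphic_derivI[OF assms(2,1,3)])
  have u: "((\<lambda>\<tau>. (1 - p\<^sup>2) * (1 - q\<^sup>2) / (1 + \<tau> * p * q)\<^sup>2) has_field_derivative
      - 2 * (1 - q\<^sup>2) * (1 - p\<^sup>2) * p * q / (1 + \<tau> * p * q) ^ 3) (at \<tau>)"
  proof (rule DERIV_cong)
    define N where "N = 1 + \<tau> * p * q"
    show "((\<lambda>\<tau>. (1 - p\<^sup>2) * (1 - q\<^sup>2) / (1 + \<tau> * p * q)\<^sup>2) has_field_derivative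
      (- ((1 - p\<^sup>2) * (1 - q\<^sup>2) * (2 * N * (p * q)))) / (N\<^sup>2 * N\<^sup>2)) (at \<tau>)"
      unfolding N_def by (auto intro!: derivative_eq_intros simp: N0)
    have "(- ((1 - p\<^sup>2) * (1 - q\<^sup>2) * (2 * N * (p * q)))) * N ^ 3 =
        (- 2 * (1 - q\<^sup>2) * (1 - p\<^sup>2) * p * q) * (N\<^sup>2 * N\<^sup>2)"
      by algebra
    then show "(- ((1 - p\<^sup>2) * (1 - q\<^sup>2) * (2 * N * (p * q)))) / (N\<^sup>2 * N\<^sup>2) =
        - 2 * (1 - q\<^sup>2) * (1 - p\<^sup>2) * p * q / (1 + \<tau> * p * q) ^ 3"
      using N0 unfolding N_def[symmetric] by (subst frac_eq_eq) simp_all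
  qed
  have E: "((\<lambda>\<tau>. exp (- \<mu> * Ln (1 + \<tau> * p * q))) has_field_derivative
      exp (- \<mu> * Ln (1 + \<tau> * p * q)) * (- \<mu> * p * q / (1 + \<tau> * p * q))) (at \<tau>)"
    using N by (auto intro!: derivative_eq_intros simp: N divide_simps)
  have gen: "E * a * F + F' * (- 2 * b * c * e * g / d) * E = a * (E * F) - 2 * b * c * e * g / d * (E * F')"
    for E a F F' b c d e g :: complex
    by (simp add: algebra_simps)
  show ?thesis
    unfolding nu_kernel_def nu_kernel_t_def
    by (rule DERIV_cong[OF DERIV_mult[OF E DERIV_chain2[OF f u]]]) (rule gen)
qed

text \<open>These are the coefficients of \<open>f u\<close>, \<open>deriv f u\<close> and
  \<open>deriv (deriv f) u\<close> in the difference of the two sides of the differential equation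
  of the kernel. All three share the factor \<open>4 (1 - q^2) p / N^2\<close>; what remains are the
  coefficients of the hypergeometric equation in \<open>u\<close>.\<close>

lemma kernel_pde_coeffs:
  fixes p q \<tau> \<mu> \<alpha> N u :: complex
  assumes N: "N = 1 + \<tau> * p * q" "N \<noteq> 0" and p: "p \<noteq> 0" and u: "u = (1 - p\<^sup>2) * (1 - q\<^sup>2) / N\<^sup>2"
  shows "p * (1 - p\<^sup>2) * (\<mu> * (\<mu> + 1) * \<tau>\<^sup>2 * q\<^sup>2 / N\<^sup>2) + (2 * \<alpha> - 2 * (\<mu> + 1) * p\<^sup>2) * (- \<mu> * \<tau> * q / N)
      - \<mu> * (\<mu> + 1) * p - ((\<tau>\<^sup>2 - 1) * (\<mu> * (\<mu> + 1) * p\<^sup>2 * q\<^sup>2 / N\<^sup>2) + 2 * \<alpha> * \<tau> * (- \<mu> * p * q / N)) / p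
      = - (1 - q\<^sup>2) * p * \<mu> * (\<mu> + 1) / N\<^sup>2" (is ?A)
    and "p * (1 - p\<^sup>2) * (2 * (1 - q\<^sup>2) * (p + \<tau> * q) * \<tau> * q * (2 * \<mu> + 3) / N ^ 4 - 2 * (1 - q\<^sup>2) / N ^ 3)
      + (2 * \<alpha> - 2 * (\<mu> + 1) * p\<^sup>2) * (- 2 * (1 - q\<^sup>2) * (p + \<tau> * q) / N ^ 3)
      - ((\<tau>\<^sup>2 - 1) * (2 * (1 - q\<^sup>2) * (1 - p\<^sup>2) * p\<^sup>2 * q\<^sup>2 * (2 * \<mu> + 3) / N ^ 4)
          + 2 * \<alpha> * \<tau> * (- 2 * (1 - q\<^sup>2) * (1 - p\<^sup>2) * p * q / N ^ 3)) / p
      = 4 * (1 - q\<^sup>2) * p / N\<^sup>2 * ((\<mu> - \<alpha> + 1) - (\<mu> + 3 / 2) * u)" (is ?B)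
    and "p * (1 - p\<^sup>2) * (4 * (1 - q\<^sup>2)\<^sup>2 * (p + \<tau> * q)\<^sup>2 / N ^ 6)
      - ((\<tau>\<^sup>2 - 1) * (4 * (1 - q\<^sup>2)\<^sup>2 * (1 - p\<^sup>2)\<^sup>2 * p\<^sup>2 * q\<^sup>2 / N ^ 6)) / p
      = 4 * (1 - q\<^sup>2) * p / N\<^sup>2 * (u * (1 - u))" (is ?C)
proof -
  \<comment> \<open>With the reciprocals as variables subject to \<open>i * N = 1\<close> and
    \<open>j * p = 1\<close>, the claims become polynomial identities within reach of
    \<open>algebra\<close>.\<close>
  define i where "i = 1 / N"
  define j where "j = 1 / p"
  have i: "i * (1 + \<tau> * p * q) = 1" using N by (simp add: i_def)
  have iN: "i * N = 1" using N by (simp add: i_def)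
  have j: "j * p = 1" using p by (simp add: j_def)
  have d: "x / N = x * i" "x / N ^ n = x * i ^ n" "x / p = x * j" for x n
    by (auto simp: i_def j_def field_simps)
  show ?A unfolding d using i j by algebra
  \<comment> \<open>The left-hand side combines the squares of the two partial derivatives of
    \<open>u\<close>. Divided by \<open>N^2\<close>, the right-hand side is
    \<open>1 - u\<close>.\<close>
  have "(p + \<tau> * q)\<^sup>2 - (\<tau>\<^sup>2 - 1) * (1 - p\<^sup>2) * q\<^sup>2 = N\<^sup>2 - (1 - p\<^sup>2) * (1 - q\<^sup>2)"
    unfolding N(1) by algebra
  then show ?C unfolding u d using iN j by algebra
  have "p * (1 - p\<^sup>2) * ((p + \<tau> * q) * \<tau> * q * (2 * \<mu> + 3) - N) - (2 * \<alpha> - 2 * (\<mu> + 1) * p\<^sup>2) * (p + \<tau> * q) * N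
      - ((\<tau>\<^sup>2 - 1) * (1 - p\<^sup>2) * p * q\<^sup>2 * (2 * \<mu> + 3) - 2 * \<alpha> * \<tau> * (1 - p\<^sup>2) * q * N)
      = 2 * p * (\<mu> - \<alpha> + 1) * N\<^sup>2 - p * (2 * \<mu> + 3) * ((1 - p\<^sup>2) * (1 - q\<^sup>2))"
    unfolding N(1) by algebra
  moreover have "4 * (1 - q\<^sup>2) * p * i\<^sup>2 * ((\<mu> - \<alpha> + 1) - (\<mu> + 3 / 2) * (u)) =
      2 * (1 - q\<^sup>2) * i\<^sup>2 * (2 * p * (\<mu> - \<alpha> + 1) - p * (2 * \<mu> + 3) * u)"
    by (simp add: field_simps)
  ultimately show ?B unfolding d using iN j u[unfolded d] by algebra
qed


text \<open>The factor \<open>2 * \<mu> + 3\<close> collects \<open>\<mu>\<close> from each of the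
  two mixed terms of the product rule and 3 from the cube of \<open>1 + \<tau> * p * q\<close> in
  the denominator.\<close>

definition nu_kernel_pp :: "complex \<Rightarrow> (complex \<Rightarrow> complex) \<Rightarrow> complex \<Rightarrow> complex \<Rightarrow> complex \<Rightarrow> complex" where
  "nu_kernel_pp \<mu> f q p \<tau> =
     \<mu> * (\<mu> + 1) * \<tau>\<^sup>2 * q\<^sup>2 / (1 + \<tau> * p * q)\<^sup>2 * nu_kernel \<mu> f q p \<tau>
     + (2 * (1 - q\<^sup>2) * (p + \<tau> * q) * \<tau> * q * (2 * \<mu> + 3) / (1 + \<tau> * p * q) ^ 4
         - 2 * (1 - q\<^sup>2) / (1 + \<tau> * p * q) ^ 3) * nu_kernel \<mu> (deriv f) q p \<tau>
     + 4 * (1 - q\<^sup>2)\<^sup>2 * (p + \<tau> * q)\<^sup>2 / (1 + \<tau> * p * q) ^ 6 * nu_kernel \<mu> (deriv (deriv f)) q p \<tau>"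

definition nu_kernel_tt :: "complex \<Rightarrow> (complex \<Rightarrow> complex) \<Rightarrow> complex \<Rightarrow> complex \<Rightarrow> complex \<Rightarrow> complex" where
  "nu_kernel_tt \<mu> f q p \<tau> =
     \<mu> * (\<mu> + 1) * p\<^sup>2 * q\<^sup>2 / (1 + \<tau> * p * q)\<^sup>2 * nu_kernel \<mu> f q p \<tau>
     + 2 * (1 - q\<^sup>2) * (1 - p\<^sup>2) * p\<^sup>2 * q\<^sup>2 * (2 * \<mu> + 3) / (1 + \<tau> * p * q) ^ 4 * nu_kernel \<mu> (deriv f) q p \<tau>
     + 4 * (1 - q\<^sup>2)\<^sup>2 * (1 - p\<^sup>2)\<^sup>2 * p\<^sup>2 * q\<^sup>2 / (1 + \<tau> * p * q) ^ 6 * nu_kernel \<mu> (deriv (deriv f)) q p \<tau>"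

lemma nu_kernel_deriv_pp:
  assumes "open W" "f holomorphic_on W" "(1 - p\<^sup>2) * (1 - q\<^sup>2) / (1 + \<tau> * p * q)\<^sup>2 \<in> W"
    and N: "1 + \<tau> * p * q \<notin> \<real>\<^sub>\<le>\<^sub>0"
  shows "((\<lambda>p. nu_kernel_p \<mu> f q p \<tau>) has_field_derivative nu_kernel_pp \<mu> f q p \<tau>) (at p)"
proof -
  define M where "M = 1 + \<tau> * p * q"
  have N0: "1 + \<tau> * p * q \<noteq> 0" and M0: "M \<noteq> 0" using N by (auto simp: M_def)
  define j where "j = 1 / M"
  have d: "x / M = x * j" "x / M ^ n = x * j ^ n" for x n
    by (auto simp: j_def field_simps)
  have jM: "j * (1 + \<tau> * p * q) = 1" using M0 by (simp add: j_def M_def)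
  have A: "((\<lambda>p. - \<mu> * \<tau> * q / (1 + \<tau> * p * q)) has_field_derivative \<mu> * \<tau>\<^sup>2 * q\<^sup>2 / M\<^sup>2) (at p)"
    unfolding M_def by (auto intro!: derivative_eq_intros simp: N0 power2_eq_square)
  have B: "((\<lambda>p. 2 * (1 - q\<^sup>2) * (p + \<tau> * q) / (1 + \<tau> * p * q) ^ 3) has_field_derivative
      (2 * (1 - q\<^sup>2) * M ^ 3 - 2 * (1 - q\<^sup>2) * (p + \<tau> * q) * (3 * M\<^sup>2 * (\<tau> * q))) / (M ^ 3 * M ^ 3)) (at p)"
    unfolding M_def by (auto intro!: derivative_eq_intros simp: N0)
  have f': "deriv f holomorphic_on W" using assms by (intro holomorphic_deriv)
  note K = nu_kernel_deriv_p[OF assms, of \<mu>] nu_kernel_deriv_p[OF assms(1) f' assms(3,4), of \<mu>]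
  have e: "(2 * (1 - q\<^sup>2) * M ^ 3 - 2 * (1 - q\<^sup>2) * (p + \<tau> * q) * (3 * M\<^sup>2 * (\<tau> * q))) / (M ^ 3 * M ^ 3) =
      2 * (1 - q\<^sup>2) / M ^ 3 - 6 * (1 - q\<^sup>2) * (p + \<tau> * q) * \<tau> * q / M ^ 4"
  proof -
    have "j * M = 1" using jM by (simp add: M_def)
    moreover have "x / (M ^ 3 * M ^ 3) = x * j ^ 6" for x by (simp add: j_def power_divide flip: power_add)
    ultimately show ?thesis unfolding d \<open>\<And>x. x / (M ^ 3 * M ^ 3) = x * j ^ 6\<close> by algebra
  qed
  show ?thesis
    unfolding nu_kernel_p_def
    by (rule DERIV_cong[OF DERIV_diff[OF DERIV_mult[OF A K(1)] DERIV_mult[OF B K(2)]]])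
       (simp only: e nu_kernel_p_def nu_kernel_pp_def flip: M_def, unfold d, algebra)
qed

lemma nu_kernel_deriv_tt:
  assumes "open W" "f holomorphic_on W" "(1 - p\<^sup>2) * (1 - q\<^sup>2) / (1 + \<tau> * p * q)\<^sup>2 \<in> W"
    and N: "1 + \<tau> * p * q \<notin> \<real>\<^sub>\<le>\<^sub>0"
  shows "((\<lambda>\<tau>. nu_kernel_t \<mu> f q p \<tau>) has_field_derivative nu_kernel_tt \<mu> f q p \<tau>) (at \<tau>)"
proof -
  define M where "M = 1 + \<tau> * p * q"
  have N0: "1 + \<tau> * p * q \<noteq> 0" and M0: "M \<noteq> 0" using N by (auto simp: M_def)
  define j where "j = 1 / M"
  have d: "x / M = x * j" "x / M ^ n = x * j ^ n" for x n
    by (auto simp: j_def field_simps)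
  have A: "((\<lambda>\<tau>. - \<mu> * p * q / (1 + \<tau> * p * q)) has_field_derivative \<mu> * p\<^sup>2 * q\<^sup>2 / M\<^sup>2) (at \<tau>)"
    unfolding M_def by (auto intro!: derivative_eq_intros simp: N0 power2_eq_square)
  have B: "((\<lambda>\<tau>. 2 * (1 - q\<^sup>2) * (1 - p\<^sup>2) * p * q / (1 + \<tau> * p * q) ^ 3) has_field_derivative
      - (2 * (1 - q\<^sup>2) * (1 - p\<^sup>2) * p * q * (3 * M\<^sup>2 * (p * q))) / (M ^ 3 * M ^ 3)) (at \<tau>)"
    unfolding M_def by (auto intro!: derivative_eq_intros simp: N0)
  have f': "deriv f holomorphic_on W" using assms by (intro holomorphic_deriv)
  note K = nu_kernel_deriv_t[OF assms, of \<mu>] nu_kernel_deriv_t[OF assms(1) f' assms(3,4), of \<mu>]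
  have e: "- (2 * (1 - q\<^sup>2) * (1 - p\<^sup>2) * p * q * (3 * M\<^sup>2 * (p * q))) / (M ^ 3 * M ^ 3) =
      - 6 * (1 - q\<^sup>2) * (1 - p\<^sup>2) * p\<^sup>2 * q\<^sup>2 / M ^ 4"
  proof -
    have "j * M = 1" using M0 by (simp add: j_def)
    moreover have "x / (M ^ 3 * M ^ 3) = x * j ^ 6" for x by (simp add: j_def power_divide flip: power_add)
    ultimately show ?thesis unfolding d \<open>\<And>x. x / (M ^ 3 * M ^ 3) = x * j ^ 6\<close> by algebra
  qed
  show ?thesis
    unfolding nu_kernel_t_def
    by (rule DERIV_cong[OF DERIV_diff[OF DERIV_mult[OF A K(1)] DERIV_mult[OF B K(2)]]])
       (simp only: e nu_kernel_t_def nu_kernel_tt_def flip: M_def, unfold d, algebra)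
qed

text \<open>The left-hand side is the hypergeometric operator in \<open>x = 1 - p\<^sup>2\<close>, multiplied by \<open>4 p\<close>. After
  multiplication with the weight, the right-hand side is the \<open>t\<close>-derivative of
  \<open>(t\<^sup>2 - 1) powr \<alpha> * nu_kernel_t\<close> divided by \<open>p\<close>. This is the Laplacian of hyperbolic space in polar
  coordinates, in dimension \<open>2 \<alpha> + 1\<close>.\<close>

lemma nu_kernel_pde:
  fixes p q \<tau> \<mu> \<alpha> :: complex
  assumes u: "u = (1 - p\<^sup>2) * (1 - q\<^sup>2) / (1 + \<tau> * p * q)\<^sup>2"
    and N: "1 + \<tau> * p * q \<noteq> 0" and p: "p \<noteq> 0"
    and ode: "u * (1 - u) * deriv (deriv f) u + ((\<mu> - \<alpha> + 1) - (\<mu> + 3 / 2) * u) * deriv f u - \<mu> * (\<mu> + 1) / 4 * f u = 0"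
  shows "p * (1 - p\<^sup>2) * nu_kernel_pp \<mu> f q p \<tau> + (2 * \<alpha> - 2 * (\<mu> + 1) * p\<^sup>2) * nu_kernel_p \<mu> f q p \<tau>
      - \<mu> * (\<mu> + 1) * p * nu_kernel \<mu> f q p \<tau> =
    ((\<tau>\<^sup>2 - 1) * nu_kernel_tt \<mu> f q p \<tau> + 2 * \<alpha> * \<tau> * nu_kernel_t \<mu> f q p \<tau>) / p"
proof -
  define M where "M = 1 + \<tau> * p * q"
  define E where "E = exp (- \<mu> * Ln M)"
  define c0 c1 c2 where "c0 = - (1 - q\<^sup>2) * p * \<mu> * (\<mu> + 1) / M\<^sup>2"
    and "c1 = 4 * (1 - q\<^sup>2) * p / M\<^sup>2 * ((\<mu> - \<alpha> + 1) - (\<mu> + 3 / 2) * u)"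
    and "c2 = 4 * (1 - q\<^sup>2) * p / M\<^sup>2 * (u * (1 - u))"
  have lin: "x * (a1 * F0 + b1 * F1 + d1 * F2) + y * (a2 * F0 - b2 * F1) - z * F0
      - (v * (a3 * F0 + b3 * F1 + d3 * F2) + w * (a4 * F0 - b4 * F1)) / p
    = (x * a1 + y * a2 - z - (v * a3 + w * a4) / p) * F0 + (x * b1 + y * (- b2) - (v * b3 + w * (- b4)) / p) * F1
      + (x * d1 - (v * d3) / p) * F2" for x y z v w a1 a2 a3 a4 b1 b2 b3 b4 d1 d3 F0 F1 F2 :: complex
    by (simp add: algebra_simps add_divide_distrib diff_divide_distrib)
  have k: "nu_kernel \<mu> g q p \<tau> = E * g u" for g
    by (simp add: nu_kernel_def E_def M_def u)
  have neg: "- (2 * a * b / M ^ 3) = - 2 * a * b / M ^ 3" "- (2 * a * b * c * e / M ^ 3) = - 2 * a * b * c * e / M ^ 3"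
    for a b c e by simp_all
  have c: "M \<noteq> 0" "u = (1 - p\<^sup>2) * (1 - q\<^sup>2) / M\<^sup>2" using N u by (simp_all add: M_def)
  note c = kernel_pde_coeffs(1)[OF M_def c(1) p c(2), of \<mu> \<alpha>] kernel_pde_coeffs(2)[OF M_def c(1) p c(2), of \<mu> \<alpha>]
    kernel_pde_coeffs(3)[OF M_def c(1) p c(2)]
  have "p * (1 - p\<^sup>2) * nu_kernel_pp \<mu> f q p \<tau> + (2 * \<alpha> - 2 * (\<mu> + 1) * p\<^sup>2) * nu_kernel_p \<mu> f q p \<tau>
      - \<mu> * (\<mu> + 1) * p * nu_kernel \<mu> f q p \<tau> -
    ((\<tau>\<^sup>2 - 1) * nu_kernel_tt \<mu> f q p \<tau> + 2 * \<alpha> * \<tau> * nu_kernel_t \<mu> f q p \<tau>) / p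
    = c0 * (E * f u) + c1 * (E * deriv f u) + c2 * (E * deriv (deriv f) u)"
    unfolding nu_kernel_pp_def nu_kernel_p_def nu_kernel_tt_def nu_kernel_t_def k lin M_def[symmetric] neg
    unfolding c c0_def c1_def c2_def by (rule refl)
  also have "\<dots> = 4 * (1 - q\<^sup>2) * p / M\<^sup>2 * E * (u * (1 - u) * deriv (deriv f) u +
      ((\<mu> - \<alpha> + 1) - (\<mu> + 3 / 2) * u) * deriv f u - \<mu> * (\<mu> + 1) / 4 * f u)"
  proof -
    define w c Y where "w = \<mu> * (\<mu> + 1) / 4" and "c = (\<mu> - \<alpha> + 1) - (\<mu> + 3 / 2) * u"
      and "Y = 4 * (1 - q\<^sup>2) * p / M\<^sup>2"
    have "4 * x * y / z * (v / 4) = x * y * v / z" for x y z v :: complex by simp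
    then have "Y * w = (1 - q\<^sup>2) * p * (\<mu> * (\<mu> + 1)) / M\<^sup>2" unfolding Y_def w_def .
    then have "c0 = - Y * w" unfolding c0_def by (simp only: mult_minus_left minus_divide_left mult.assoc)
    then show ?thesis unfolding c1_def c2_def w_def[symmetric] c_def[symmetric] Y_def[symmetric] by algebra
  qed
  also have "\<dots> = 0" unfolding ode by simp
  finally show ?thesis by simp
qed

section \<open>Half-plane geometry and growth of the kernel\<close>

lemma Re_inverse_pos: "Re z > 0 \<Longrightarrow> Re (inverse z) > 0"
  by (simp add: add_pos_nonneg)

lemma Re_of_real_mult: "Re (of_real c * z) = c * Re z"
  by simp

text \<open>Otherwise \<open>p\<close> would be a nonpositive multiple of \<open>1 / q\<close>,
  whose real part is positive. The case \<open>s = 0\<close> is the limit of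
  \<open>1 + t p q\<close>, rescaled by \<open>1 + t\<close>, as \<open>t\<close> tends to
  infinity.\<close>

lemma mix_not_nonpos:
  fixes s r :: real
  assumes "Re p > 0" "Re q > 0" "s \<ge> 0" "r \<ge> 0" "s + r > 0"
  shows "of_real s + of_real r * p * q \<notin> \<real>\<^sub>\<le>\<^sub>0"
proof
  assume "of_real s + of_real r * p * q \<in> \<real>\<^sub>\<le>\<^sub>0"
  then obtain x where x: "of_real s + of_real r * p * q = of_real x" "x \<le> 0"
    by (auto elim!: nonpos_Reals_cases)
  show False
  proof (cases "r = 0")
    case True
    then show False using x assms by simp
  next
    case False
    have "p * (of_real r * q) = of_real (x - s)" using x by (simp add: algebra_simps)
    moreover have "q \<noteq> 0" using assms by auto
    ultimately have "p = of_real ((x - s) / r) * inverse q"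
      using False by (simp add: field_simps)
    then have "Re p = (x - s) / r * Re (inverse q)" by (simp only: Re_of_real_mult)
    moreover have "(x - s) / r \<le> 0" using x assms False by (simp add: divide_le_0_iff)
    ultimately have "Re p \<le> 0" using Re_inverse_pos[OF assms(2)] by (simp only: mult_nonpos_nonneg less_imp_le)
    then show False using assms by simp
  qed
qed

definition hyp_plane :: "complex set" where
  "hyp_plane = - (complex_of_real ` {1..})"

text \<open>If the value were \<open>k\<^sup>2 \<ge> 1\<close>, then
  \<open>(k - 1 + (k t - 1) p q) / (p + q)\<close> and \<open>(k + 1 + (k t + 1) p q) / (p + q)\<close> would have product \<open>-1\<close>.
  But neither has a negative real part, and that of the second is positive.\<close>

lemma kernel_argument_in_hyp_plane:
  assumes p: "Re p > 0" and q: "Re q > 0" and t: "t \<ge> 1"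
  shows "(1 - p\<^sup>2) * (1 - q\<^sup>2) / (1 + of_real t * p * q)\<^sup>2 \<in> hyp_plane"
proof (rule ccontr)
  assume "\<not> ?thesis"
  then obtain x where x: "(1 - p\<^sup>2) * (1 - q\<^sup>2) / (1 + of_real t * p * q)\<^sup>2 = of_real x" "x \<ge> 1"
    by (auto simp: hyp_plane_def)
  define k where "k = sqrt x"
  have k: "x = k\<^sup>2" "k \<ge> 1" using x by (auto simp: k_def)
  have kt: "k * t \<ge> 1" using k(2) t mult_mono[of 1 k 1 t] by simp
  have N: "1 + of_real t * p * q \<noteq> 0"
    using mix_not_nonpos[OF p q, of 1 t] t by auto
  have eq: "(1 - p\<^sup>2) * (1 - q\<^sup>2) = (of_real k)\<^sup>2 * (1 + of_real t * p * q)\<^sup>2"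
    using x(1) N unfolding k by (simp add: field_simps)
  have nz: "p \<noteq> 0" "q \<noteq> 0" "p + q \<noteq> 0" using p q
    by (auto simp: add_eq_0_iff)
  define U where "U = (of_real (k - 1) + of_real (k * t - 1) * (p * q)) / (p + q)"
  define V where "V = (of_real (k + 1) + of_real (k * t + 1) * (p * q)) / (p + q)"
  \<comment> \<open>A difference of squares: the product is
    \<open>k^2 (1 + t p q)^2 - (1 + p q)^2\<close>, and by \<open>eq\<close> this is
    \<open>(1 - p^2) (1 - q^2) - (1 + p q)^2\<close>.\<close>
  have "(of_real (k - 1) + of_real (k * t - 1) * (p * q)) * (of_real (k + 1) + of_real (k * t + 1) * (p * q)) = - (p + q)\<^sup>2"
    using eq unfolding of_real_diff of_real_add of_real_mult of_real_1 by algebra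
  then have UV: "U * V = - 1" unfolding U_def V_def times_divide_times_eq using nz by (simp only: power2_eq_square) simp
  have inv: "Re (inverse (p + q)) > 0" using p q by (intro Re_inverse_pos) simp
  have "p * q / (p + q) = inverse (inverse p + inverse q)" using nz by (simp add: field_simps)
  then have inv2: "Re (p * q / (p + q)) > 0"
    using Re_inverse_pos[of "inverse p + inverse q"] Re_inverse_pos[OF p] Re_inverse_pos[OF q] by simp
  have split: "Re ((of_real a + of_real b * (p * q)) / (p + q)) = a * Re (inverse (p + q)) + b * Re (p * q / (p + q))" for a b
  proof -
    have "(of_real a + of_real b * (p * q)) / (p + q) = of_real a * inverse (p + q) + of_real b * (p * q / (p + q))"
      by (simp only: divide_inverse distrib_right mult.assoc)
    then show ?thesis by (simp only: plus_complex.sel(1) Re_of_real_mult)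
  qed
  have "Re U \<ge> 0" unfolding U_def split using inv inv2 k kt by (intro add_nonneg_nonneg mult_nonneg_nonneg) auto
  moreover have "Re V > 0" unfolding V_def split using inv inv2 k t by (intro add_pos_pos mult_pos_pos) auto
  moreover have "U = - inverse V"
  proof -
    have "V \<noteq> 0" using UV by auto
    then have "U = U * V * inverse V" by simp
    then show ?thesis unfolding UV by simp
  qed
  ultimately show False using Re_inverse_pos[of V] by (simp del: inverse_complex.sel)
qed

text \<open>In the variable \<open>s = 1 / (1 + t)\<close> the quotient of the kernel by \<open>(1 + t) powr (- \<mu>)\<close> extends
  continuously to \<open>s = 0\<close>, so it is bounded on a compact set.\<close>

lemma kernel_bound:
  assumes p0: "Re p0 > 0" and q: "Re q > 0" and \<phi>: "continuous_on W \<phi>"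
    and W: "0 \<in> W" "\<And>p t. Re p > 0 \<Longrightarrow> t \<ge> 1 \<Longrightarrow> (1 - p\<^sup>2) * (1 - q\<^sup>2) / (1 + of_real t * p * q)\<^sup>2 \<in> W"
  shows "\<exists>r>0. \<exists>C\<ge>0. ball p0 r \<subseteq> {p. Re p > 0} \<and> (\<forall>p\<in>ball p0 r. \<forall>t\<ge>1.
    norm (nu_kernel \<mu> \<phi> q p (of_real t)) \<le> C * norm (of_real (1 + t) powr (- \<mu>)))"
proof -
  define r where "r = Re p0 / 2"
  define D where "D = (\<lambda>(p, s). of_real s + of_real (1 - s) * p * q :: complex)"
  define G where "G = (\<lambda>(p, s). exp (- \<mu> * Ln (D (p, s))) * \<phi> ((1 - p\<^sup>2) * (1 - q\<^sup>2) * (of_real s)\<^sup>2 / (D (p, s))\<^sup>2))"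
  have r: "r > 0" using p0 by (simp add: r_def)
  have sub: "Re p > 0" if "p \<in> cball p0 r" for p
    using that abs_Re_le_cmod[of "p0 - p"] p0 by (auto simp: dist_norm r_def)
  \<comment> \<open>The interval \<open>{0..1/2}\<close> corresponds to \<open>t \<ge> 1\<close>
    with infinity added. At \<open>s = 0\<close> the base is \<open>p * q\<close>, still off the cut
    of \<open>Ln\<close>.\<close>
  have D: "D (p, s) \<notin> \<real>\<^sub>\<le>\<^sub>0" if "p \<in> cball p0 r" "s \<in> {0..1/2}" for p s
    unfolding D_def using mix_not_nonpos[OF sub[OF that(1)] q, of s "1 - s"] that by auto
  have resc: "1 + of_real t * p * q = of_real (1 + t) * D (p, 1 / (1 + t))" if "t \<ge> 1" for t p
    using that by (simp add: D_def field_simps flip: of_real_add) (simp add: field_simps)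
  have u: "(1 - p\<^sup>2) * (1 - q\<^sup>2) * (of_real (1 / (1 + t)))\<^sup>2 / (D (p, 1 / (1 + t)))\<^sup>2 =
      (1 - p\<^sup>2) * (1 - q\<^sup>2) / (1 + of_real t * p * q)\<^sup>2" if "t \<ge> 1" for t p
  proof -
    have "complex_of_real (1 + t) \<noteq> 0" using that by (simp only: of_real_eq_0_iff)
    then show ?thesis unfolding resc[OF that] of_real_divide of_real_1 by (simp add: power_mult_distrib power_divide)
  qed
  have inW: "(1 - p\<^sup>2) * (1 - q\<^sup>2) * (of_real s)\<^sup>2 / (D (p, s))\<^sup>2 \<in> W" if ps: "p \<in> cball p0 r" "s \<in> {0..1/2}" for p s
  proof (cases "s = 0")
    case False
    define t where "t = 1 / s - 1"
    have t: "t \<ge> 1" "s = 1 / (1 + t)" using False ps by (auto simp: t_def field_simps)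
    show ?thesis using u[OF t(1), of p] W(2)[OF sub[OF ps(1)] t(1)] unfolding t(2)[symmetric] by simp
  qed (use W in simp)
  have contD: "continuous_on (cball p0 r \<times> {0..1/2}) D"
    unfolding D_def split_def by (intro continuous_intros)
  have "continuous_on (cball p0 r \<times> {0..1/2}) G"
    unfolding G_def split_def prod.collapse
    by (intro continuous_intros contD continuous_on_compose2[OF \<phi>]) (use D inW in force)+
  moreover have "compact (cball p0 r \<times> {0..1/2::real})" by (intro compact_Times) auto
  ultimately have "bounded (G ` (cball p0 r \<times> {0..1/2}))"
    by (intro compact_imp_bounded compact_continuous_image)
  then obtain C where C: "C > 0" "\<And>p s. p \<in> cball p0 r \<Longrightarrow> s \<in> {0..1/2} \<Longrightarrow> norm (G (p, s)) \<le> C"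
    unfolding bounded_pos by force
  have "norm (nu_kernel \<mu> \<phi> q p (of_real t)) \<le> C * norm (of_real (1 + t) powr (- \<mu>))"
    if p: "p \<in> ball p0 r" and t: "t \<ge> 1" for p t
  proof -
    have s: "1 / (1 + t) \<in> {0..1/2}" using t by (auto simp: field_simps)
    have pc: "p \<in> cball p0 r" using p by auto
    have "D (p, 1 / (1 + t)) \<noteq> 0" using D[OF pc s] by auto
    then have "Ln (of_real (1 + t) * D (p, 1 / (1 + t))) = of_real (ln (1 + t)) + Ln (D (p, 1 / (1 + t)))"
      using t by (subst Ln_times_of_real) (auto simp: Ln_of_real simp del: of_real_add)
    then have "Ln (1 + of_real t * p * q) = of_real (ln (1 + t)) + Ln (D (p, 1 / (1 + t)))"
      by (simp only: resc[OF t])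
    then have "exp (- \<mu> * Ln (1 + of_real t * p * q)) = of_real (1 + t) powr (- \<mu>) * exp (- \<mu> * Ln (D (p, 1 / (1 + t))))"
    proof -
      have 1: "complex_of_real (1 + t) powr (- \<mu>) = exp (- \<mu> * of_real (ln (1 + t)))"
        using t Ln_of_real[of "1 + t"] unfolding powr_def by (simp del: of_real_add)
      show ?thesis unfolding 1 \<open>Ln (1 + of_real t * p * q) = _\<close> exp_add[symmetric] distrib_left ..
    qed
    then have "nu_kernel \<mu> \<phi> q p (of_real t) = of_real (1 + t) powr (- \<mu>) * G (p, 1 / (1 + t))"
      unfolding nu_kernel_def G_def split_conv u[OF t] by (simp only: mult.assoc)
    then have "norm (nu_kernel \<mu> \<phi> q p (of_real t)) = norm (G (p, 1 / (1 + t))) * norm (complex_of_real (1 + t) powr (- \<mu>))"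
      by (simp only: norm_mult mult.commute)
    then show ?thesis using mult_right_mono[OF C(2)[OF pc s] norm_ge_zero] by metis
  qed
  then show ?thesis using r C(1) sub by (intro exI[of _ r] exI[of _ C] conjI) (auto simp del: of_real_add)
qed

section \<open>Differentiation and integration by parts for the kernel integral\<close>

lemma dominated_on_cong:
  assumes "dominated_on S T g" "\<And>z t. z \<in> S \<Longrightarrow> t \<in> T \<Longrightarrow> g z t = g' z t"
  shows "dominated_on S T g'"
  unfolding dominated_on_def
proof (intro conjI ballI)
  show "open S" using assms by (simp add: dominated_on_def)
next
  fix t assume "t \<in> T"
  then show "(\<lambda>z. g' z t) holomorphic_on S"
    using assms unfolding dominated_on_def by (metis (no_types, lifting) holomorphic_cong)
next
  fix z assume "z \<in> S"
  then show "g' z integrable_on T"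
    using assms unfolding dominated_on_def by (metis (no_types, lifting) integrable_cong)
next
  fix z0 assume "z0 \<in> S"
  then obtain r B where "r > 0" "ball z0 r \<subseteq> S" "B integrable_on T" "\<forall>z\<in>ball z0 r. \<forall>t\<in>T. norm (g z t) \<le> B t"
    using assms(1) unfolding dominated_on_def by meson
  then show "\<exists>r>0. \<exists>B. ball z0 r \<subseteq> S \<and> B integrable_on T \<and> (\<forall>z\<in>ball z0 r. \<forall>t\<in>T. norm (g' z t) \<le> B t)"
    using assms(2) by (intro exI[of _ r] conjI exI[of _ B]) (auto simp: subset_iff)
qed

lemma dominated_on_absolutely_integrable:
  assumes "dominated_on S T g" "z \<in> S"
  shows "g z absolutely_integrable_on T"
proof -
  obtain r B where "r > 0" "B integrable_on T" "\<forall>z\<in>ball z r. \<forall>t\<in>T. norm (g z t) \<le> B t"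
    using assms unfolding dominated_on_def by meson
  moreover have "g z integrable_on T" using assms by (simp add: dominated_on_def)
  ultimately show ?thesis by (intro absolutely_integrable_integrable_bound[of T "g z" B]) auto
qed

lemma dominated_on_has_derivative:
  assumes "dominated_on S T g"
    and der: "\<And>z t. z \<in> S \<Longrightarrow> t \<in> T \<Longrightarrow> ((\<lambda>z. g z t) has_field_derivative g' z t) (at z)"
  shows "dominated_on S T g'"
    and "z \<in> S \<Longrightarrow> ((\<lambda>z. integral T (g z)) has_field_derivative integral T (g' z)) (at z)"
proof -
  have eq: "deriv (\<lambda>z. g z t) z = g' z t" if "z \<in> S" "t \<in> T" for z t
    using der[OF that] by (rule DERIV_imp_deriv)
  show "dominated_on S T g'"
    by (rule dominated_on_cong[OF dominated_on_deriv[OF assms(1)] eq])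
  assume z: "z \<in> S"
  have "integral T (\<lambda>t. deriv (\<lambda>z. g z t) z) = integral T (g' z)"
    by (rule integral_cong) (rule eq[OF z])
  then show "((\<lambda>z. integral T (g z)) has_field_derivative integral T (g' z)) (at z)"
    using dominated_on_integral_deriv(2)[OF assms(1) z] by simp
qed

text \<open>The fundamental theorem on \<open>{a..a + k}\<close> gives \<open>K (a + k)\<close>, and
  the truncated integrals converge by domination with \<open>norm (L t)\<close>. No derivative is
  asked for at \<open>a\<close>, since the weight may be unbounded there.\<close>

lemma integral_eq_0_of_antiderivative:
  fixes K L :: "real \<Rightarrow> complex"
  assumes "continuous_on {a..} K" "K a = 0"
    and "\<And>t. t > a \<Longrightarrow> (K has_vector_derivative L t) (at t)"
    and "L absolutely_integrable_on {a<..}" and "(K \<longlongrightarrow> 0) at_top"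
  shows "integral {a<..} L = 0"
proof -
  define F where "F = (\<lambda>k t. if t \<in> {a..a + real k} then L t else 0)"
  have FTC: "(L has_integral K (a + real k)) {a..a + real k}" for k
  proof -
    have "(L has_integral K (a + real k) - K a) {a..a + real k}"
      by (rule fundamental_theorem_of_calculus_interior)
         (use assms(1,3) in \<open>auto intro: continuous_on_subset\<close>)
    then show ?thesis using assms(2) by simp
  qed
  have F: "(F k has_integral K (a + real k)) {a<..}" for k
  proof -
    have "(F k has_integral K (a + real k)) {a..}"
      using has_integral_restrict[of "{a..a + real k}" "{a..}" L] FTC[of k] unfolding F_def by auto
    then show ?thesis
      by (subst (asm) has_integral_spike_set_eq[of _ "{a<..}"]) (auto intro: negligible_subset[of "{a}"])
  qed
  have conv: "(\<lambda>k. integral {a<..} (F k)) \<longlonglongrightarrow> integral {a<..} L"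
  proof (rule dominated_convergence)
    show "F k integrable_on {a<..}" for k using F by blast
    show "(\<lambda>t. norm (L t)) integrable_on {a<..}"
      using assms(4) by (simp add: absolutely_integrable_on_def)
    show "norm (F k t) \<le> norm (L t)" for k t by (simp add: F_def)
    show "(\<lambda>k. F k t) \<longlonglongrightarrow> L t" if "t \<in> {a<..}" for t
    proof (rule tendsto_eventually)
      show "\<forall>\<^sub>F k in sequentially. F k t = L t"
        using eventually_ge_at_top[of "nat \<lceil>t - a\<rceil>"]
      proof eventually_elim
        fix k assume "nat \<lceil>t - a\<rceil> \<le> k"
        then have "t \<le> a + real k" by linarith
        then show "F k t = L t" using that by (simp add: F_def)
      qed
    qed
  qed
  moreover have "(\<lambda>k. integral {a<..} (F k)) \<longlonglongrightarrow> 0"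
  proof -
    have "integral {a<..} (F k) = K (a + real k)" for k using F by (rule integral_unique)
    moreover have "filterlim (\<lambda>k. a + real k) at_top sequentially"
      by (intro filterlim_tendsto_add_at_top[OF tendsto_const] filterlim_real_sequentially)
    ultimately show ?thesis using filterlim_compose[OF assms(5)] by simp
  qed
  ultimately show ?thesis by (rule LIMSEQ_unique)
qed

definition kernel_integral :: "complex \<Rightarrow> complex \<Rightarrow> (complex \<Rightarrow> complex) \<Rightarrow> complex \<Rightarrow> complex \<Rightarrow> complex" where
  "kernel_integral lam \<alpha> f q p =
     integral {1<..} (\<lambda>t. nu_kernel (lam + 2 * \<alpha>) f q p (of_real t) * weight \<alpha> t)"

text \<open>Two instances are needed: a linear \<open>f\<close> on the whole plane with
  \<open>q = 1\<close>, and \<open>hyp_cont\<close> on \<open>hyp_plane\<close> with general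
  \<open>q\<close>. The set \<open>W\<close> contains 0 as the limit of the arguments for
  \<open>t\<close> tending to infinity, and \<open>arg_W\<close> includes \<open>t = 1\<close>
  because the boundary term must be continuous there.\<close>

locale kernel_setting =
  fixes lam \<alpha> :: complex and W :: "complex set" and f :: "complex \<Rightarrow> complex" and q :: complex
  assumes re_alpha: "Re \<alpha> > 0" and re_lam: "Re lam > -1" and re_q: "Re q > 0"
    and open_W: "open W" and hol_f: "f holomorphic_on W" and zero_W: "0 \<in> W"
    and arg_W: "\<And>p t. Re p > 0 \<Longrightarrow> t \<ge> 1 \<Longrightarrow> (1 - p\<^sup>2) * (1 - q\<^sup>2) / (1 + of_real t * p * q)\<^sup>2 \<in> W"
begin

abbreviation (input) \<mu> where "\<mu> \<equiv> lam + 2 * \<alpha>"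

lemma N_notin: "Re p > 0 \<Longrightarrow> t \<ge> 1 \<Longrightarrow> 1 + of_real t * p * q \<notin> \<real>\<^sub>\<le>\<^sub>0"
  using mix_not_nonpos[of p q 1 t] re_q by simp

lemma hol_f': "deriv f holomorphic_on W"
  using open_W hol_f by (intro holomorphic_deriv)

lemmas deriv_p = nu_kernel_deriv_p[OF open_W hol_f arg_W N_notin]
  and deriv_pp = nu_kernel_deriv_pp[OF open_W hol_f arg_W N_notin]
  and deriv_t = nu_kernel_deriv_t[OF open_W hol_f arg_W N_notin]
  and deriv_tt = nu_kernel_deriv_tt[OF open_W hol_f arg_W N_notin]

text \<open>Locally uniformly in \<open>p\<close> the kernel is at most a constant times the norm of
  \<open>of_real (1 + t) powr (- \<mu>)\<close>. Multiplied by the weight, this is the integrand of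
  the Beta integral above.\<close>

lemma dominated: "dominated_on {p. Re p > 0} {1<..} (\<lambda>p t. nu_kernel \<mu> f q p (of_real t) * weight \<alpha> t)"
proof -
  define f0 where "f0 = (\<lambda>t. of_real (1 + t) powr (- \<mu>) * weight \<alpha> t)"
  have f0: "(\<lambda>t. norm (f0 t)) integrable_on {1<..}"
    using integral_algebraic_weight(1)[OF re_alpha re_lam] unfolding f0_def absolutely_integrable_on_def by blast
  have bound: "\<exists>r>0. \<exists>B. ball p0 r \<subseteq> {p. Re p > 0} \<and> B integrable_on {1<..} \<and>
      (\<forall>p\<in>ball p0 r. \<forall>t\<in>{1<..}. norm (nu_kernel \<mu> f q p (of_real t) * weight \<alpha> t) \<le> B t)" if p0: "Re p0 > 0" for p0
  proof -
    obtain r C where r: "r > 0" "C \<ge> 0" "ball p0 r \<subseteq> {p. Re p > 0}"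
      and C: "\<And>p t. p \<in> ball p0 r \<Longrightarrow> t \<ge> 1 \<Longrightarrow> norm (nu_kernel \<mu> f q p (of_real t)) \<le> C * norm (of_real (1 + t) powr (- \<mu>))"
      using kernel_bound[OF p0 re_q holomorphic_on_imp_continuous_on[OF hol_f] zero_W arg_W, of \<mu>] by meson
    have "norm (nu_kernel \<mu> f q p (of_real t) * weight \<alpha> t) \<le> C * norm (f0 t)" if "p \<in> ball p0 r" "t \<in> {1<..}" for p t
      using mult_right_mono[OF C[OF that(1), of t], of "norm (weight \<alpha> t)"] that
      by (simp add: norm_mult f0_def mult.assoc del: of_real_add)
    moreover have "(\<lambda>t. C * norm (f0 t)) integrable_on {1<..}"
      by (rule integrable_on_mult_right[OF f0])
    ultimately show ?thesis using r by (intro exI[of _ r] conjI exI[of _ "\<lambda>t. C * norm (f0 t)"]) auto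
  qed
  show ?thesis unfolding dominated_on_def
  proof (intro conjI ballI)
    fix t :: real assume t: "t \<in> {1<..}"
    show "(\<lambda>p. nu_kernel \<mu> f q p (of_real t) * weight \<alpha> t) holomorphic_on {p. Re p > 0}"
    proof (intro holomorphic_on_mult holomorphic_on_const)
      show "(\<lambda>p. nu_kernel \<mu> f q p (of_real t)) holomorphic_on {p. Re p > 0}"
        unfolding holomorphic_on_open[OF open_halfspace_Re_gt]
      proof (intro ballI exI)
        fix p assume "p \<in> {p. Re p > 0}"
        then show "((\<lambda>p. nu_kernel \<mu> f q p (of_real t)) has_field_derivative nu_kernel_p \<mu> f q p (of_real t)) (at p)"
          using t by (intro deriv_p) auto
      qed
    qed
  next
    fix p :: complex assume p: "p \<in> {p. Re p > 0}"
    obtain B where B: "B integrable_on {1<..}"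
      "\<And>t. t \<in> {1<..} \<Longrightarrow> norm (nu_kernel \<mu> f q p (of_real t) * weight \<alpha> t) \<le> B t"
      using bound[of p] p by (auto simp del: of_real_add)
    have "continuous_on {1<..} (\<lambda>t. nu_kernel \<mu> f q p (of_real t))"
    proof (rule continuous_at_imp_continuous_on, rule ballI)
      fix t :: real assume "t \<in> {1<..}"
      then have "isCont (nu_kernel \<mu> f q p) (of_real t)"
        using deriv_t[of p t] p by (auto intro: DERIV_isCont)
      then show "isCont (\<lambda>t. nu_kernel \<mu> f q p (of_real t)) t"
        by (simp add: isCont_o2)
    qed
    moreover have "continuous_on {1<..} (weight \<alpha>)"
    proof -
      have "t * t > 1" if "t > 1" for t :: real using that by (simp add: less_1_mult)
      then have "t * t \<ge> 1 \<and> complex_of_real t * complex_of_real t \<noteq> 1" if "t > 1" for t :: real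
        using that by (metis less_imp_le less_irrefl of_real_eq_1_iff of_real_mult)
      then show ?thesis
        unfolding weight_def by (intro continuous_intros) (auto simp: power2_eq_square)
    qed
    ultimately show "(\<lambda>t. nu_kernel \<mu> f q p (of_real t) * weight \<alpha> t) integrable_on {1<..}"
      by (intro continuous_dominated_integrable(1)[OF _ _ B] continuous_on_mult) auto
  qed (use bound in \<open>auto simp: open_halfspace_Re_gt\<close>)
qed

lemma integral_deriv:
  assumes "Re p > 0"
  shows "(kernel_integral lam \<alpha> f q has_field_derivative
            integral {1<..} (\<lambda>t. nu_kernel_p \<mu> f q p (of_real t) * weight \<alpha> t)) (at p)"
    and "((\<lambda>p. integral {1<..} (\<lambda>t. nu_kernel_p \<mu> f q p (of_real t) * weight \<alpha> t)) has_field_derivative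
            integral {1<..} (\<lambda>t. nu_kernel_pp \<mu> f q p (of_real t) * weight \<alpha> t)) (at p)"
    and "dominated_on {p. Re p > 0} {1<..} (\<lambda>p t. nu_kernel_p \<mu> f q p (of_real t) * weight \<alpha> t)"
    and "dominated_on {p. Re p > 0} {1<..} (\<lambda>p t. nu_kernel_pp \<mu> f q p (of_real t) * weight \<alpha> t)"
proof -
  have d1: "((\<lambda>p. nu_kernel \<mu> f q p (of_real t) * weight \<alpha> t) has_field_derivative nu_kernel_p \<mu> f q p (of_real t) * weight \<alpha> t) (at p)"
    if "p \<in> {p. Re p > 0}" "t \<in> {1<..}" for p t
    using deriv_p that by (intro DERIV_cmult_right) auto
  have d2: "((\<lambda>p. nu_kernel_p \<mu> f q p (of_real t) * weight \<alpha> t) has_field_derivative nu_kernel_pp \<mu> f q p (of_real t) * weight \<alpha> t) (at p)"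
    if "p \<in> {p. Re p > 0}" "t \<in> {1<..}" for p t
    using deriv_pp that by (intro DERIV_cmult_right) auto
  note A = dominated_on_has_derivative[OF dominated d1]
  note B = dominated_on_has_derivative[OF A(1) d2]
  show "(kernel_integral lam \<alpha> f q has_field_derivative
            integral {1<..} (\<lambda>t. nu_kernel_p \<mu> f q p (of_real t) * weight \<alpha> t)) (at p)"
    using A(2) assms unfolding kernel_integral_def[abs_def] by simp
  show "((\<lambda>p. integral {1<..} (\<lambda>t. nu_kernel_p \<mu> f q p (of_real t) * weight \<alpha> t)) has_field_derivative
            integral {1<..} (\<lambda>t. nu_kernel_pp \<mu> f q p (of_real t) * weight \<alpha> t)) (at p)"
    using B(2) assms by simp
  show "dominated_on {p. Re p > 0} {1<..} (\<lambda>p t. nu_kernel_p \<mu> f q p (of_real t) * weight \<alpha> t)" by (rule A(1))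
  show "dominated_on {p. Re p > 0} {1<..} (\<lambda>p t. nu_kernel_pp \<mu> f q p (of_real t) * weight \<alpha> t)" by (rule B(1))
qed

text \<open>Differentiation in \<open>t\<close> brings at least one factor
  \<open>1 / (1 + t p q)\<close> and thus gains a power of \<open>1 + t\<close>. This gain makes the
  boundary term vanish at infinity.\<close>

lemma norm_nu_kernel_t_bound:
  assumes p: "Re p > 0"
  shows "\<exists>C. \<forall>t\<ge>1. norm (nu_kernel_t \<mu> f q p (of_real t)) \<le> C * (1 + t) powr (- Re \<mu> - 1)"
proof -
  have bnd: "\<exists>C\<ge>0. \<forall>t\<ge>1. norm (nu_kernel m g q p (of_real t)) \<le> C * (1 + t) powr (- Re m)"
    if g: "continuous_on W g" for g and m
  proof -
    obtain r C where r: "r > 0" "C \<ge> 0"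
      and C: "\<forall>p'\<in>ball p r. \<forall>t\<ge>1. norm (nu_kernel m g q p' (of_real t)) \<le> C * norm (of_real (1 + t) powr (- m))"
      using kernel_bound[OF p re_q g zero_W arg_W, of m] by meson
    have "norm (complex_of_real (1 + t) powr (- m)) = (1 + t) powr (- Re m)" if "t \<ge> 1" for t
      using that by (subst norm_powr_real_powr) auto
    then show ?thesis using C r by (intro exI[of _ C]) (auto simp del: of_real_add)
  qed
  obtain C0 where C0: "C0 \<ge> 0" "\<And>t. t \<ge> 1 \<Longrightarrow> norm (nu_kernel \<mu> f q p (of_real t)) \<le> C0 * (1 + t) powr (- Re \<mu>)"
    using bnd[OF holomorphic_on_imp_continuous_on[OF hol_f], of \<mu>] by meson
  obtain C1 where C1: "C1 \<ge> 0" "\<And>t. t \<ge> 1 \<Longrightarrow> norm (nu_kernel \<mu> (deriv f) q p (of_real t)) \<le> C1 * (1 + t) powr (- Re \<mu>)"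
    using bnd[OF holomorphic_on_imp_continuous_on[OF hol_f'], of \<mu>] by meson
  \<comment> \<open>\<open>1 / (1 + t p q)\<close> is itself a kernel, with exponent 1 and constant
    \<open>f\<close>, so the same growth bound covers it.\<close>
  obtain C2 where C2: "C2 \<ge> 0" "\<And>t. t \<ge> 1 \<Longrightarrow> norm (nu_kernel 1 (\<lambda>_. 1) q p (of_real t)) \<le> C2 * (1 + t) powr (- 1)"
    using bnd[OF continuous_on_const, of 1 1] by auto
  define D0 D1 where "D0 = norm (\<mu> * p * q)" and "D1 = norm (2 * (1 - q\<^sup>2) * (1 - p\<^sup>2) * p * q)"
  have "norm (nu_kernel_t \<mu> f q p (of_real t)) \<le> (D0 * C2 * C0 + D1 * C2 ^ 3 * C1) * (1 + t) powr (- Re \<mu> - 1)"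
    if t: "t \<ge> 1" for t
  proof -
    define N where "N = 1 + of_real t * p * q"
    define s where "s = (1 + t) powr (- Re \<mu>)"
    have N0: "N \<noteq> 0" using N_notin[OF p t] by (auto simp: N_def)
    have inv: "norm (inverse N) \<le> C2 / (1 + t)"
    proof -
      have "nu_kernel 1 (\<lambda>_. 1) q p (of_real t) = inverse N"
        using N0 by (simp add: nu_kernel_def N_def exp_minus)
      then show ?thesis using C2(2)[OF t] t by (simp add: powr_minus divide_inverse)
    qed
    have inv3: "norm (inverse N) ^ 3 \<le> C2 ^ 3 / (1 + t)"
    proof -
      have "norm (inverse N) ^ 3 \<le> (C2 / (1 + t)) ^ 3" by (intro power_mono inv) auto
      also have "\<dots> = C2 ^ 3 / (1 + t) ^ 3" by (simp add: power_divide)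
      also have "\<dots> \<le> C2 ^ 3 / (1 + t)"
        using C2(1) t self_le_power[of "1 + t" 3] by (intro divide_left_mono) auto
      finally show ?thesis .
    qed
    have "nu_kernel_t \<mu> f q p (of_real t) = - (\<mu> * p * q) * inverse N * nu_kernel \<mu> f q p (of_real t) -
        2 * (1 - q\<^sup>2) * (1 - p\<^sup>2) * p * q * inverse N ^ 3 * nu_kernel \<mu> (deriv f) q p (of_real t)"
      unfolding nu_kernel_t_def N_def divide_inverse power_inverse by (simp only: mult_minus_left)
    then have "norm (nu_kernel_t \<mu> f q p (of_real t)) \<le>
        D0 * norm (inverse N) * norm (nu_kernel \<mu> f q p (of_real t)) +
        D1 * norm (inverse N) ^ 3 * norm (nu_kernel \<mu> (deriv f) q p (of_real t))"
      unfolding D0_def D1_def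
      by (metis (no_types, lifting) norm_triangle_ineq4 norm_mult norm_minus_cancel norm_power)
    also have "\<dots> \<le> D0 * (C2 / (1 + t)) * (C0 * s) + D1 * (C2 ^ 3 / (1 + t)) * (C1 * s)"
      unfolding s_def using C0 C1 C2(1) t
      by (intro add_mono mult_mono inv inv3) (auto simp: D0_def D1_def)
    also have "\<dots> = (D0 * C2 * C0 + D1 * C2 ^ 3 * C1) * (s / (1 + t))"
    proof -
      have "D0 * (C2 / y) * (C0 * s) + D1 * (C2 ^ 3 / y) * (C1 * s) = (D0 * C2 * C0 + D1 * C2 ^ 3 * C1) * (s / y)" for y
        by (simp add: algebra_simps add_divide_distrib)
      then show ?thesis .
    qed
    also have "s / (1 + t) = (1 + t) powr (- Re \<mu> - 1)"
      using t unfolding s_def by (simp add: powr_diff)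
    finally show ?thesis .
  qed
  then show ?thesis by blast
qed

text \<open>The growth exponents add up to
  \<open>2 * Re \<alpha> - Re \<mu> - 1 = - Re lam - 1\<close>, which is negative by
  \<open>re_lam\<close>.\<close>

lemma boundary_term_tendsto:
  assumes p: "Re p > 0"
  shows "((\<lambda>t. of_real (t\<^sup>2 - 1) powr \<alpha> * nu_kernel_t \<mu> f q p (of_real t)) \<longlongrightarrow> 0) at_top"
proof -
  obtain C where C: "\<And>t. t \<ge> 1 \<Longrightarrow> norm (nu_kernel_t \<mu> f q p (of_real t)) \<le> C * (1 + t) powr (- Re \<mu> - 1)"
    using norm_nu_kernel_t_bound[OF p] by blast
  have le: "norm (of_real (t\<^sup>2 - 1) powr \<alpha> * nu_kernel_t \<mu> f q p (of_real t)) \<le> C * (1 + t) powr (- Re lam - 1)"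
    if t: "t > 1" for t
  proof -
    have "norm (complex_of_real (t\<^sup>2 - 1) powr \<alpha>) = (t\<^sup>2 - 1) powr Re \<alpha>"
      using t by (subst norm_powr_real_powr) (auto simp del: of_real_diff)
    also have "\<dots> \<le> ((1 + t) ^ 2) powr Re \<alpha>"
      using t re_alpha by (intro powr_mono2) (auto simp: power2_eq_square algebra_simps less_imp_le[OF less_1_mult])
    also have "\<dots> = (1 + t) powr (2 * Re \<alpha>)"
      using t by (simp add: powr_powr flip: powr_numeral)
    finally have "norm (of_real (t\<^sup>2 - 1) powr \<alpha> * nu_kernel_t \<mu> f q p (of_real t)) \<le>
        (1 + t) powr (2 * Re \<alpha>) * (C * (1 + t) powr (- Re \<mu> - 1))"
      unfolding norm_mult using C[of t] t by (intro mult_mono) auto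
    also have "\<dots> = C * (1 + t) powr (2 * Re \<alpha> + (- Re \<mu> - 1))"
      unfolding powr_add by simp
    finally show ?thesis by simp
  qed
  have "((\<lambda>t. C * (1 + t) powr (- Re lam - 1)) \<longlongrightarrow> C * 0) at_top"
  proof (intro tendsto_mult tendsto_const tendsto_neg_powr)
    show "- Re lam - 1 < 0" using re_lam by simp
    show "filterlim (\<lambda>t::real. 1 + t) at_top at_top"
      by (intro filterlim_tendsto_add_at_top[OF tendsto_const] filterlim_ident)
  qed
  then show ?thesis
    by (intro Lim_null_comparison[OF eventually_mono[OF eventually_gt_at_top[of 1] le]]) simp_all
qed

text \<open>After multiplication with the weight, the \<open>t\<close>-part of the kernel equation
  is a total derivative with vanishing boundary values. The equation for \<open>f\<close> is
  demanded only at arguments that occur for the given \<open>p\<close>; for \<open>q = 1\<close>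
  this is the single point 0.\<close>

lemma integral_ode:
  assumes p: "Re p > 0"
    and ode: "\<And>t u. t > 1 \<Longrightarrow> u = (1 - p\<^sup>2) * (1 - q\<^sup>2) / (1 + of_real t * p * q)\<^sup>2 \<Longrightarrow> u * (1 - u) * deriv (deriv f) u + ((\<mu> - \<alpha> + 1) - (\<mu> + 3 / 2) * u) * deriv f u - \<mu> * (\<mu> + 1) / 4 * f u = 0"
  defines "h \<equiv> kernel_integral lam \<alpha> f q"
  shows "p * (1 - p\<^sup>2) * deriv (deriv h) p + (2 * \<alpha> - 2 * (\<mu> + 1) * p\<^sup>2) * deriv h p - \<mu> * (\<mu> + 1) * p * h p = 0"
proof -
  define g gp gpp where "g = (\<lambda>t. nu_kernel \<mu> f q p (of_real t) * weight \<alpha> t)"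
    and "gp = (\<lambda>t. nu_kernel_p \<mu> f q p (of_real t) * weight \<alpha> t)"
    and "gpp = (\<lambda>t. nu_kernel_pp \<mu> f q p (of_real t) * weight \<alpha> t)"
  define K where "K = (\<lambda>t. of_real (t\<^sup>2 - 1) powr \<alpha> * nu_kernel_t \<mu> f q p (of_real t))"
  define L where "L = (\<lambda>t. weight \<alpha> t * ((of_real t ^ 2 - 1) * nu_kernel_tt \<mu> f q p (of_real t) + 2 * \<alpha> * of_real t * nu_kernel_t \<mu> f q p (of_real t)))"
  have p0: "p \<noteq> 0" using p by auto
  have abs: "g absolutely_integrable_on {1<..}" "gp absolutely_integrable_on {1<..}" "gpp absolutely_integrable_on {1<..}"
    using dominated_on_absolutely_integrable[of _ _ _ p] dominated integral_deriv(3,4)[OF p] p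
    unfolding g_def gp_def gpp_def by blast+
  have int: "g integrable_on {1<..}" "gp integrable_on {1<..}" "gpp integrable_on {1<..}"
    using abs set_lebesgue_integral_eq_integral(1) by blast+
  \<comment> \<open>The factor \<open>p\<close> clears the denominator in the kernel equation.
    Absolute integrability of \<open>L\<close> is obtained from this form, so no bound on the second
    \<open>t\<close>-derivative is needed.\<close>
  have L: "L t = p * (p * (1 - p\<^sup>2) * gpp t + (2 * \<alpha> - 2 * (\<mu> + 1) * p\<^sup>2) * gp t - \<mu> * (\<mu> + 1) * p * g t)"
    if t: "t > 1" for t
  proof -
    note pde = nu_kernel_pde[OF refl _ p0 ode[OF t refl]]
    have "1 + of_real t * p * q \<noteq> 0" using N_notin[OF p, of t] t by auto
    note pde = pde[OF this]
    have "L t = p * weight \<alpha> t * (((of_real t ^ 2 - 1) * nu_kernel_tt \<mu> f q p (of_real t) + 2 * \<alpha> * of_real t * nu_kernel_t \<mu> f q p (of_real t)) / p)"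
      unfolding L_def using p0 by simp
    then show ?thesis unfolding pde[symmetric] g_def gp_def gpp_def by (simp add: algebra_simps)
  qed
  have "integral {1<..} L = 0"
  proof (rule integral_eq_0_of_antiderivative)
    have contKt: "continuous_on {1..} (\<lambda>t. nu_kernel_t \<mu> f q p (of_real t))"
    proof (rule continuous_at_imp_continuous_on, rule ballI)
      fix t :: real assume "t \<in> {1..}"
      then have "isCont (nu_kernel_t \<mu> f q p) (of_real t)"
        using deriv_tt[of p t] p by (auto intro: DERIV_isCont)
      then show "isCont (\<lambda>t. nu_kernel_t \<mu> f q p (of_real t)) t"
        by (simp add: isCont_o2)
    qed
    \<comment> \<open>At \<open>t = 1\<close> the base of the power is 0;
      \<open>Re \<alpha> > 0\<close> makes the power continuous there, with value
      \<open>0 powr \<alpha> = 0\<close>.\<close>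
    show "continuous_on {1..} K"
      unfolding K_def
      by (intro continuous_on_mult contKt continuous_on_powr_complex continuous_intros)
         (use re_alpha in \<open>auto simp: power2_eq_square intro: mult_ge1_I\<close>)
    show "K 1 = 0" by (simp add: K_def)
    show "(K \<longlongrightarrow> 0) at_top" unfolding K_def by (rule boundary_term_tendsto[OF p])
    have "(\<lambda>t. p * (p * (1 - p\<^sup>2) * gpp t + (2 * \<alpha> - 2 * (\<mu> + 1) * p\<^sup>2) * gp t - \<mu> * (\<mu> + 1) * p * g t)) absolutely_integrable_on {1<..}"
      by (intro set_integrable_mult_right set_integral_add set_integral_diff abs)
    then show "L absolutely_integrable_on {1<..}"
      by (rule set_integrable_cong[THEN iffD1, rotated -1]) (auto simp: L)
    show "(K has_vector_derivative L t) (at t)" if t: "t > 1" for t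
    proof -
      have sq: "complex_of_real (t\<^sup>2 - 1) \<notin> \<real>\<^sub>\<le>\<^sub>0" using t by (auto simp: complex_nonpos_Reals_iff power2_eq_square less_1_mult simp del: of_real_diff dest: leD)
      then have sq': "(complex_of_real t)\<^sup>2 - 1 \<notin> \<real>\<^sub>\<le>\<^sub>0" by simp
      then have sq0: "(complex_of_real t)\<^sup>2 - 1 \<noteq> 0" by auto
      have "((\<lambda>\<tau>. (\<tau>\<^sup>2 - 1) powr \<alpha>) has_field_derivative (2 * of_real t * \<alpha> * ((of_real t)\<^sup>2 - 1) powr (\<alpha> - 1))) (at (of_real t))"
        using sq' by (auto intro!: derivative_eq_intros)
      from DERIV_mult[OF this deriv_tt[of p t \<mu>]] 
      have "((\<lambda>\<tau>. (\<tau>\<^sup>2 - 1) powr \<alpha> * nu_kernel_t \<mu> f q p \<tau>) has_field_derivative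
          2 * of_real t * \<alpha> * ((of_real t)\<^sup>2 - 1) powr (\<alpha> - 1) * nu_kernel_t \<mu> f q p (of_real t) +
          nu_kernel_tt \<mu> f q p (of_real t) * ((of_real t)\<^sup>2 - 1) powr \<alpha>) (at (of_real t))"
        using p t by auto
      also have "2 * of_real t * \<alpha> * ((of_real t)\<^sup>2 - 1) powr (\<alpha> - 1) * nu_kernel_t \<mu> f q p (of_real t) +
          nu_kernel_tt \<mu> f q p (of_real t) * ((of_real t)\<^sup>2 - 1) powr \<alpha> = L t"
      proof -
        have "((complex_of_real t)\<^sup>2 - 1) powr \<alpha> = ((of_real t)\<^sup>2 - 1) * ((of_real t)\<^sup>2 - 1) powr (\<alpha> - 1)"
          using sq0 powr_add[of "(complex_of_real t)\<^sup>2 - 1" 1 "\<alpha> - 1"] by simp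
        then show ?thesis unfolding L_def weight_def of_real_diff of_real_power of_real_1 by algebra
      qed
      finally have "((\<lambda>t. (\<lambda>\<tau>. (\<tau>\<^sup>2 - 1) powr \<alpha> * nu_kernel_t \<mu> f q p \<tau>) (of_real t)) has_vector_derivative L t) (at t)"
        by (rule has_vector_derivative_real_field)
      then show ?thesis by (simp add: K_def)
    qed
  qed
  moreover have "integral {1<..} L = p * (p * (1 - p\<^sup>2) * integral {1<..} gpp + (2 * \<alpha> - 2 * (\<mu> + 1) * p\<^sup>2) * integral {1<..} gp
      - \<mu> * (\<mu> + 1) * p * integral {1<..} g)"
  proof -
    have "((\<lambda>t. p * (p * (1 - p\<^sup>2) * gpp t + (2 * \<alpha> - 2 * (\<mu> + 1) * p\<^sup>2) * gp t - \<mu> * (\<mu> + 1) * p * g t)) has_integral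
      p * (p * (1 - p\<^sup>2) * integral {1<..} gpp + (2 * \<alpha> - 2 * (\<mu> + 1) * p\<^sup>2) * integral {1<..} gp
      - \<mu> * (\<mu> + 1) * p * integral {1<..} g)) {1<..}"
      by (intro has_integral_mult_right has_integral_add has_integral_diff integrable_integral int)
    then have "(L has_integral p * (p * (1 - p\<^sup>2) * integral {1<..} gpp + (2 * \<alpha> - 2 * (\<mu> + 1) * p\<^sup>2) * integral {1<..} gp
      - \<mu> * (\<mu> + 1) * p * integral {1<..} g)) {1<..}"
      by (rule has_integral_eq[rotated]) (auto simp: L)
    then show ?thesis by (rule integral_unique)
  qed
  moreover have "deriv h p = integral {1<..} gp"
    unfolding h_def gp_def by (rule DERIV_imp_deriv[OF integral_deriv(1)[OF p]])
  moreover have "deriv (deriv h) p = integral {1<..} gpp"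
  proof -
    have "deriv (deriv h) p = deriv (\<lambda>p. integral {1<..} (\<lambda>t. nu_kernel_p \<mu> f q p (of_real t) * weight \<alpha> t)) p"
    proof (rule deriv_cong_ev)
      have "\<forall>\<^sub>F p in nhds p. p \<in> {p. Re p > 0}"
        using p by (intro eventually_nhds_in_open) (auto simp: open_halfspace_Re_gt)
      then show "\<forall>\<^sub>F p in nhds p. deriv h p = integral {1<..} (\<lambda>t. nu_kernel_p \<mu> f q p (of_real t) * weight \<alpha> t)"
        unfolding h_def by eventually_elim (auto intro!: DERIV_imp_deriv integral_deriv(1))
    qed simp
    then show ?thesis
      unfolding gpp_def using DERIV_imp_deriv[OF integral_deriv(2)[OF p]] by simp
  qed
  moreover have "h p = integral {1<..} g" by (simp add: h_def kernel_integral_def g_def)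
  ultimately show ?thesis using p0 by simp
qed

lemma integral_holomorphic: "kernel_integral lam \<alpha> f q holomorphic_on {p. Re p > 0}"
  using integral_deriv(1) by (auto simp: holomorphic_on_open open_halfspace_Re_gt)

end

section \<open>The product formula in the variable p\<close>

lemma in_hyp_plane_iff: "x \<in> hyp_plane \<longleftrightarrow> 1 - x \<notin> \<real>\<^sub>\<le>\<^sub>0"
proof -
  have "x \<in> complex_of_real ` {1..} \<longleftrightarrow> 1 - x \<in> \<real>\<^sub>\<le>\<^sub>0"
  proof
    assume "1 - x \<in> \<real>\<^sub>\<le>\<^sub>0"
    then obtain r where "1 - x = of_real r" "r \<le> 0" by (auto elim!: nonpos_Reals_cases)
    then have "x = of_real (1 - r)" "1 - r \<in> {1..}" by (auto simp: algebra_simps)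
    then show "x \<in> complex_of_real ` {1..}" by blast
  qed (auto simp: complex_nonpos_Reals_iff)
  then show ?thesis by (simp add: hyp_plane_def)
qed

lemma open_hyp_plane: "open hyp_plane"
  unfolding hyp_plane_def by (intro open_Compl closed_slot_right)

lemma ball_subset_hyp_plane: "ball 0 1 \<subseteq> hyp_plane"
  by (auto simp: hyp_plane_def)

lemma connected_hyp_plane: "connected hyp_plane"
proof -
  have "starlike hyp_plane"
    unfolding starlike_def
  proof (intro bexI[of _ 0] ballI subsetI)
    fix x y assume x: "x \<in> hyp_plane" and y: "y \<in> closed_segment 0 x"
    then obtain u where u: "0 \<le> u" "u \<le> 1" "y = of_real u * x"
      by (auto simp: in_segment scaleR_conv_of_real)
    show "y \<in> hyp_plane"
    proof (rule ccontr)
      assume "y \<notin> hyp_plane"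
      then obtain r where r: "of_real u * x = complex_of_real r" "r \<ge> 1" using u by (auto simp: hyp_plane_def)
      then have "u \<noteq> 0" by auto
      then have "x = of_real (r / u)" "r / u \<in> {1..}" using r u by (auto simp: field_simps)
      then show False using x unfolding hyp_plane_def by blast
    qed
  qed (use ball_subset_hyp_plane in auto)
  then show ?thesis by (rule starlike_imp_connected)
qed

lemma Re_csqrt_pos: "z \<notin> \<real>\<^sub>\<le>\<^sub>0 \<Longrightarrow> Re (csqrt z) > 0"
proof (rule ccontr)
  assume z: "z \<notin> \<real>\<^sub>\<le>\<^sub>0" and "\<not> Re (csqrt z) > 0"
  then have "Re (csqrt z) = 0" using csqrt_principal[of z] by auto
  then have "(csqrt z)\<^sup>2 \<in> \<real>\<^sub>\<le>\<^sub>0" by (simp add: complex_nonpos_Reals_iff power2_eq_square del: power2_csqrt)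
  then show False using z by simp
qed

text \<open>Substituting \<open>x = 1 - p^2\<close> turns \<open>4 * p\<close> times the
  hypergeometric operator into the operator in \<open>p\<close>. The principal root maps
  \<open>1 - x\<close> back into the half-plane, so \<open>f\<close> is holomorphic at the singular
  point \<open>x = 0\<close> as well.\<close>

lemma csqrt_transform_ode:
  assumes hol: "h holomorphic_on {p. Re p > 0}"
    and ode: "\<And>p. Re p > 0 \<Longrightarrow>
      p * (1 - p\<^sup>2) * deriv (deriv h) p + (2 * \<alpha> - 2 * (\<mu> + 1) * p\<^sup>2) * deriv h p - \<mu> * (\<mu> + 1) * p * h p = 0"
  defines "f \<equiv> \<lambda>x. h (csqrt (1 - x))"
  shows "f holomorphic_on hyp_plane"
    and "x \<in> hyp_plane \<Longrightarrow> x * (1 - x) * deriv (deriv f) x + ((\<mu> - \<alpha> + 1) - (\<mu> + 3 / 2) * x) * deriv f x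
           - \<mu> * (\<mu> + 1) / 4 * f x = 0"
proof -
  note op = open_halfspace_Re_gt[of 0]
  have hol': "deriv h holomorphic_on {p. Re p > 0}" using hol op by (intro holomorphic_deriv)
  have s: "((\<lambda>x. csqrt (1 - x)) has_field_derivative - 1 / (2 * csqrt (1 - x))) (at x)" if "x \<in> hyp_plane" for x
  proof (rule DERIV_cong)
    have a: "((\<lambda>x. 1 - x) has_field_derivative - 1) (at x)" by (auto intro!: derivative_eq_intros)
    have b: "1 - x \<notin> \<real>\<^sub>\<le>\<^sub>0" using that by (simp add: in_hyp_plane_iff)
    show "((\<lambda>x. csqrt (1 - x)) has_field_derivative inverse (2 * csqrt (1 - x)) * - 1) (at x)"
      by (rule DERIV_chain2[OF has_field_derivative_csqrt[OF b] a])
  qed (simp add: field_simps)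
  have R: "Re (csqrt (1 - x)) > 0" if "x \<in> hyp_plane" for x
    by (rule Re_csqrt_pos[OF that[unfolded in_hyp_plane_iff]])
  have d1: "(f has_field_derivative deriv h (csqrt (1 - x)) * (- 1 / (2 * csqrt (1 - x)))) (at x)" if x: "x \<in> hyp_plane" for x
    unfolding f_def by (rule DERIV_chain2[OF holomorphic_derivI[OF hol op] s[OF x]]) (use R[OF x] in simp)
  then show "f holomorphic_on hyp_plane" by (auto simp: holomorphic_on_open[OF open_hyp_plane])
  assume x: "x \<in> hyp_plane"
  define p where "p = csqrt (1 - x)"
  have p: "Re p > 0" "p \<noteq> 0" "x = 1 - p\<^sup>2" using R[OF x] by (auto simp: p_def)
  have e1: "deriv f x = - deriv h p / (2 * p)" using DERIV_imp_deriv[OF d1[OF x]] by (simp add: p_def)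
  have e2: "deriv (deriv f) x = deriv (deriv h) p / (4 * p\<^sup>2) - deriv h p / (4 * p ^ 3)"
  proof -
    have "deriv (deriv f) x = deriv (\<lambda>x. deriv h (csqrt (1 - x)) * (- 1 / (2 * csqrt (1 - x)))) x"
    proof (rule deriv_cong_ev)
      have "\<forall>\<^sub>F x in nhds x. x \<in> hyp_plane" using x open_hyp_plane by (rule eventually_nhds_in_open[rotated])
      then show "\<forall>\<^sub>F x in nhds x. deriv f x = deriv h (csqrt (1 - x)) * (- 1 / (2 * csqrt (1 - x)))"
        by eventually_elim (rule DERIV_imp_deriv[OF d1])
    qed simp
    also have "\<dots> = deriv (deriv h) p * (- 1 / (2 * p)) * (- 1 / (2 * p)) + (- 1 / (2 * p) / (2 * p\<^sup>2)) * deriv h p"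
    proof (rule DERIV_imp_deriv)
      have a: "((\<lambda>x. deriv h (csqrt (1 - x))) has_field_derivative deriv (deriv h) p * (- 1 / (2 * p))) (at x)"
        unfolding p_def by (rule DERIV_chain2[OF holomorphic_derivI[OF hol' op] s[OF x]]) (use R[OF x] in simp)
      have b: "((\<lambda>x. - 1 / (2 * csqrt (1 - x))) has_field_derivative - 1 / (2 * p) / (2 * p\<^sup>2)) (at x)"
      proof (rule DERIV_cong)
        show "((\<lambda>x. - 1 / (2 * csqrt (1 - x))) has_field_derivative
            (0 * (2 * csqrt (1 - x)) - (- 1) * (2 * (- 1 / (2 * csqrt (1 - x))))) / (2 * csqrt (1 - x) * (2 * csqrt (1 - x)))) (at x)"
          by (intro DERIV_divide DERIV_const DERIV_cmult s[OF x]) (use p(2) in \<open>simp add: p_def\<close>)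
      qed (use p(2) in \<open>simp add: power2_eq_square flip: p_def\<close>)
      show "((\<lambda>x. deriv h (csqrt (1 - x)) * (- 1 / (2 * csqrt (1 - x)))) has_field_derivative
          deriv (deriv h) p * (- 1 / (2 * p)) * (- 1 / (2 * p)) + (- 1 / (2 * p) / (2 * p\<^sup>2)) * deriv h p) (at x)"
        using DERIV_mult[OF a b] by (simp add: p_def)
    qed
    also have "\<dots> = deriv (deriv h) p / (4 * p\<^sup>2) - deriv h p / (4 * p ^ 3)"
      using p(2) by (simp add: power2_eq_square power3_eq_cube)
    finally show ?thesis .
  qed
  have "4 * p * (x * (1 - x) * deriv (deriv f) x + ((\<mu> - \<alpha> + 1) - (\<mu> + 3 / 2) * x) * deriv f x
           - \<mu> * (\<mu> + 1) / 4 * f x) =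
      p * (1 - p\<^sup>2) * deriv (deriv h) p + (2 * \<alpha> - 2 * (\<mu> + 1) * p\<^sup>2) * deriv h p - \<mu> * (\<mu> + 1) * p * h p"
  proof -
    define H0 H1 H2 i where "H0 = h p" and "H1 = deriv h p" and "H2 = deriv (deriv h) p" and "i = 1 / p"
    have i: "i * p = 1" using p by (simp add: i_def)
    have e: "deriv f x = - H1 * i / 2" "deriv (deriv f) x = (H2 * i\<^sup>2 - H1 * i ^ 3) / 4" "f x = H0"
      unfolding e1 e2 by (simp_all add: H1_def H2_def i_def power_divide diff_divide_distrib mult.commute)
         (simp add: H0_def f_def p_def)
    have "4 * p * (x * (1 - x) * deriv (deriv f) x + ((\<mu> - \<alpha> + 1) - (\<mu> + 3 / 2) * x) * deriv f x
           - \<mu> * (\<mu> + 1) / 4 * f x) =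
      p * (x * (1 - x) * (H2 * i\<^sup>2 - H1 * i ^ 3) - (2 * (\<mu> - \<alpha> + 1) - (2 * \<mu> + 3) * x) * (H1 * i) - \<mu> * (\<mu> + 1) * H0)"
      unfolding e by (simp add: field_simps)
    also have "\<dots> = p * (1 - p\<^sup>2) * H2 + (2 * \<alpha> - 2 * (\<mu> + 1) * p\<^sup>2) * H1 - \<mu> * (\<mu> + 1) * p * H0"
      unfolding p(3) using i by algebra
    finally show ?thesis by (simp add: H0_def H1_def H2_def)
  qed
  also have "\<dots> = 0" by (rule ode[OF p(1)])
  finally show "x * (1 - x) * deriv (deriv f) x + ((\<mu> - \<alpha> + 1) - (\<mu> + 3 / 2) * x) * deriv f x
           - \<mu> * (\<mu> + 1) / 4 * f x = 0" using p(2) by simp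
qed

text \<open>In the unit disc both functions are multiples of the same series, and the relation
  extends by the identity theorem, as \<open>hyp_plane\<close> is connected.\<close>

lemma hypergeometric_ode_proportional:
  assumes "f holomorphic_on hyp_plane" "g holomorphic_on hyp_plane"
    and "\<And>x. x \<in> hyp_plane \<Longrightarrow>
      x * (1 - x) * deriv (deriv f) x + (c - (a + b + 1) * x) * deriv f x - a * b * f x = 0"
    and "\<And>x. x \<in> hyp_plane \<Longrightarrow>
      x * (1 - x) * deriv (deriv g) x + (c - (a + b + 1) * x) * deriv g x - a * b * g x = 0"
    and c: "c \<notin> \<int>\<^sub>\<le>\<^sub>0" and x: "x \<in> hyp_plane"
  shows "f x * g 0 = f 0 * g x"
proof -
  have r: "rGamma c \<noteq> 0" using c by (simp add: rGamma_eq_zero_iff)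
  have ball: "f x * g 0 - f 0 * g x = 0" if x: "x \<in> ball 0 1" for x
  proof -
    have "rGamma c * f x = f 0 * reg_hyp2F1 a b c x" "rGamma c * g x = g 0 * reg_hyp2F1 a b c x"
      using assms ball_subset_hyp_plane x
      by (auto intro!: hypergeometric_ode_solution intro: holomorphic_on_subset)
    then have "rGamma c * (f x * g 0 - f 0 * g x) = 0" by algebra
    then show ?thesis using r by simp
  qed
  have "f x * g 0 - f 0 * g x = 0"
    by (rule analytic_continuation_open[of "ball 0 1" hyp_plane "\<lambda>x. f x * g 0 - f 0 * g x" "\<lambda>_. 0"])
       (use ball assms open_hyp_plane connected_hyp_plane ball_subset_hyp_plane in \<open>auto intro!: holomorphic_intros\<close>)
  then show ?thesis by simp
qed

section \<open>The Laplace integral and its product formula\<close>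

definition laplace_integral :: "complex \<Rightarrow> complex \<Rightarrow> complex \<Rightarrow> complex" where
  "laplace_integral lam \<alpha> p = integral {1<..} (\<lambda>t. exp (- (lam + 2 * \<alpha>) * Ln (1 + of_real t * p)) * weight \<alpha> t)"

text \<open>Up to a constant factor this is the continuation of the Gauss series to the plane cut along
  \<open>[1, \<infinity>)\<close>.\<close>

definition hyp_cont :: "complex \<Rightarrow> complex \<Rightarrow> complex \<Rightarrow> complex" where
  "hyp_cont lam \<alpha> x = laplace_integral lam \<alpha> (csqrt (1 - x))"

text \<open>If one of the two variables is 1, the argument of \<open>f\<close> is constantly 0. The
  first form yields the equation for the Laplace integral, the second the value at
  \<open>x = 0\<close> in the product formula.\<close>

lemma kernel_integral_one:
  assumes "f 0 = c"
  shows "kernel_integral lam \<alpha> f 1 p = c * laplace_integral lam \<alpha> p"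
    and "kernel_integral lam \<alpha> f p 1 = c * laplace_integral lam \<alpha> p"
  using assms by (simp_all add: kernel_integral_def laplace_integral_def nu_kernel_def mult.assoc flip: integral_mult_right) (simp_all add: mult_ac)

context
  fixes lam \<alpha> :: complex
  assumes re_alpha: "Re \<alpha> > 0" and re_lam: "Re lam > -1"
begin

abbreviation (input) mu where "mu \<equiv> lam + 2 * \<alpha>"

lemma c_notin: "lam + \<alpha> + 1 \<notin> \<int>\<^sub>\<le>\<^sub>0"
  using re_alpha re_lam by (auto elim!: nonpos_Ints_cases simp: complex_eq_iff)

lemma hyp_cont_0: "hyp_cont lam \<alpha> 0 = 2 powr (- lam - 1) * Beta (lam + 1) \<alpha>"
proof -
  have "laplace_integral lam \<alpha> 1 = integral {1<..} (\<lambda>t. of_real (1 + t) powr (- mu) * weight \<alpha> t)"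
    unfolding laplace_integral_def
  proof (rule integral_cong)
    fix t :: real assume "t \<in> {1<..}"
    then have "complex_of_real (1 + t) \<noteq> 0" by (simp only: of_real_eq_0_iff) simp
    then show "exp (- mu * Ln (1 + of_real t * 1)) * weight \<alpha> t = of_real (1 + t) powr (- mu) * weight \<alpha> t"
      by (simp add: powr_def)
  qed
  then show ?thesis using integral_algebraic_weight(2)[OF re_alpha re_lam] by (simp add: hyp_cont_def)
qed

lemma hyp_cont_0_nonzero: "hyp_cont lam \<alpha> 0 \<noteq> 0"
proof -
  have nz: "z \<notin> \<int>\<^sub>\<le>\<^sub>0" if "Re z > 0" for z :: complex using that by (auto elim!: nonpos_Ints_cases)
  have "Gamma (lam + 1) \<noteq> 0" "Gamma \<alpha> \<noteq> 0" "Gamma (lam + 1 + \<alpha>) \<noteq> 0"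
    using re_alpha re_lam nz by (auto simp: Gamma_eq_zero_iff)
  then show ?thesis unfolding hyp_cont_0 by (simp add: Beta_def)
qed

text \<open>An explicit polynomial can stand in for a solution of the hypergeometric equation here.
  This breaks the circle: \<open>hyp_cont\<close> is shown to satisfy the equation before it is used
  inside a kernel.\<close>

lemma laplace_integral_ode:
  shows "laplace_integral lam \<alpha> holomorphic_on {p. Re p > 0}"
    and "Re p > 0 \<Longrightarrow> p * (1 - p\<^sup>2) * deriv (deriv (laplace_integral lam \<alpha>)) p +
      (2 * \<alpha> - 2 * (mu + 1) * p\<^sup>2) * deriv (laplace_integral lam \<alpha>) p - mu * (mu + 1) * p * laplace_integral lam \<alpha> p = 0"
proof -
  define d where "d = mu * (mu + 1) / 4 / (mu - \<alpha> + 1)"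
  have c: "mu - \<alpha> + 1 \<noteq> 0" using c_notin by (auto simp: algebra_simps)
  \<comment> \<open>for \<open>q = 1\<close> the kernel only uses the equation at 0, which the first two Taylor coefficients satisfy\<close>
  define f where "f = (\<lambda>x. 1 + d * x)"
  have f': "deriv f x = d" for x
    unfolding f_def by (rule DERIV_imp_deriv) (auto intro!: derivative_eq_intros)
  have eq: "kernel_integral lam \<alpha> f 1 = laplace_integral lam \<alpha>"
    by (rule ext) (subst kernel_integral_one(1)[of _ 1], auto simp: f_def)
  interpret kernel_setting lam \<alpha> UNIV f 1
    by unfold_locales (use re_alpha re_lam in \<open>auto simp: f_def intro!: holomorphic_intros\<close>)
  show "laplace_integral lam \<alpha> holomorphic_on {p. Re p > 0}"
    using integral_holomorphic unfolding eq .
  assume p: "Re p > 0"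
  show "p * (1 - p\<^sup>2) * deriv (deriv (laplace_integral lam \<alpha>)) p +
      (2 * \<alpha> - 2 * (mu + 1) * p\<^sup>2) * deriv (laplace_integral lam \<alpha>) p - mu * (mu + 1) * p * laplace_integral lam \<alpha> p = 0"
  proof (rule integral_ode[OF p, unfolded eq])
    fix u t assume "u = (1 - p\<^sup>2) * (1 - 1\<^sup>2) / (1 + complex_of_real t * p * 1)\<^sup>2"
    then have "u = 0" by simp
    moreover have "f 0 = 1" "(mu - \<alpha> + 1) * d = mu * (mu + 1) / 4"
    proof -
      have "x * (y / x) = y" if "x \<noteq> 0" for x y :: complex using that by simp
      then show "(mu - \<alpha> + 1) * d = mu * (mu + 1) / 4" using c unfolding d_def by blast
    qed (simp add: f_def)
    ultimately show "u * (1 - u) * deriv (deriv f) u + ((mu - \<alpha> + 1) - (mu + 3 / 2) * u) * deriv f u - mu * (mu + 1) / 4 * f u = 0"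
      by (simp only: f') simp
  qed
qed

lemma hyp_cont_ode:
  shows "hyp_cont lam \<alpha> holomorphic_on hyp_plane"
    and "x \<in> hyp_plane \<Longrightarrow> x * (1 - x) * deriv (deriv (hyp_cont lam \<alpha>)) x +
      ((mu - \<alpha> + 1) - (mu + 3 / 2) * x) * deriv (hyp_cont lam \<alpha>) x - mu * (mu + 1) / 4 * hyp_cont lam \<alpha> x = 0"
  using csqrt_transform_ode[OF laplace_integral_ode] unfolding hyp_cont_def[abs_def] by blast+

lemma ode_params:
  "(c - (lam / 2 + \<alpha> + (lam / 2 + \<alpha> + 1 / 2) + 1) * x) = (c - (mu + 3 / 2) * x)"
  "(lam / 2 + \<alpha>) * (lam / 2 + \<alpha> + 1 / 2) = mu * (mu + 1) / 4"
  "lam + \<alpha> + 1 = mu - \<alpha> + 1"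
  by (simp_all add: field_simps)

lemma hyp_cont_series:
  assumes "norm x < 1"
  shows "rGamma (lam + \<alpha> + 1) * hyp_cont lam \<alpha> x =
    hyp_cont lam \<alpha> 0 * reg_hyp2F1 (lam / 2 + \<alpha>) (lam / 2 + \<alpha> + 1 / 2) (lam + \<alpha> + 1) x"
proof (rule hypergeometric_ode_solution[OF _ _ c_notin])
  show "hyp_cont lam \<alpha> holomorphic_on ball 0 1"
    using hyp_cont_ode(1) ball_subset_hyp_plane by (rule holomorphic_on_subset)
  show "x * (1 - x) * deriv (deriv (hyp_cont lam \<alpha>)) x +
      (lam + \<alpha> + 1 - (lam / 2 + \<alpha> + (lam / 2 + \<alpha> + 1 / 2) + 1) * x) * deriv (hyp_cont lam \<alpha>) x -
      (lam / 2 + \<alpha>) * (lam / 2 + \<alpha> + 1 / 2) * hyp_cont lam \<alpha> x = 0" if "x \<in> ball 0 1" for x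
    unfolding ode_params using hyp_cont_ode(2)[of x] ball_subset_hyp_plane that by blast
qed (use assms in auto)

theorem laplace_integral_product:
  assumes p: "Re p > 0" and q: "Re q > 0"
  shows "kernel_integral lam \<alpha> (hyp_cont lam \<alpha>) q p = laplace_integral lam \<alpha> p * laplace_integral lam \<alpha> q"
proof -
  interpret kernel_setting lam \<alpha> hyp_plane "hyp_cont lam \<alpha>" q
    by unfold_locales
       (use re_alpha re_lam q open_hyp_plane hyp_cont_ode ball_subset_hyp_plane kernel_argument_in_hyp_plane in auto)
  define h where "h = (\<lambda>x. kernel_integral lam \<alpha> (hyp_cont lam \<alpha>) q (csqrt (1 - x)))"
  have ode: "p * (1 - p\<^sup>2) * deriv (deriv (kernel_integral lam \<alpha> (hyp_cont lam \<alpha>) q)) p +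
      (2 * \<alpha> - 2 * (mu + 1) * p\<^sup>2) * deriv (kernel_integral lam \<alpha> (hyp_cont lam \<alpha>) q) p
      - mu * (mu + 1) * p * kernel_integral lam \<alpha> (hyp_cont lam \<alpha>) q p = 0" if p: "Re p > 0" for p
    by (rule integral_ode[OF p]) (simp only: hyp_cont_ode(2)[OF arg_W[OF p less_imp_le]])
  have H: "h holomorphic_on hyp_plane"
    "\<And>x. x \<in> hyp_plane \<Longrightarrow> x * (1 - x) * deriv (deriv h) x + ((mu - \<alpha> + 1) - (mu + 3 / 2) * x) * deriv h x
       - mu * (mu + 1) / 4 * h x = 0"
    unfolding h_def by (rule csqrt_transform_ode[OF integral_holomorphic ode], assumption+)+
  have x: "1 - p\<^sup>2 \<in> hyp_plane"
    unfolding in_hyp_plane_iff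
    by (auto simp: complex_nonpos_Reals_iff power2_eq_square) (use p mult_pos_pos[OF p p] in auto)
  have cs: "csqrt (1 - (1 - p\<^sup>2)) = p" using p csqrt_square[of p] by simp
  have "h (1 - p\<^sup>2) * hyp_cont lam \<alpha> 0 = h 0 * hyp_cont lam \<alpha> (1 - p\<^sup>2)"
    by (rule hypergeometric_ode_proportional[OF H(1) hyp_cont_ode(1) _ _ c_notin x, of "lam / 2 + \<alpha>" "lam / 2 + \<alpha> + 1 / 2"])
       (unfold ode_params, (rule H(2) hyp_cont_ode(2), assumption)+)
  \<comment> \<open>\<open>x = 0\<close> is \<open>p = 1\<close>. The nonzero factor
    \<open>hyp_cont lam \<alpha> 0\<close> occurs on both sides and cancels.\<close>
  moreover have "h 0 = hyp_cont lam \<alpha> 0 * laplace_integral lam \<alpha> q"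
    by (simp add: h_def kernel_integral_one(2)[OF refl])
  ultimately show ?thesis
    using hyp_cont_0_nonzero unfolding h_def hyp_cont_def[of _ _ "1 - p\<^sup>2"] cs by simp
qed

end

section \<open>The Gegenbauer function\<close>

text \<open>The choice operator is under control only once some extension is exhibited:
  \<open>g\<close> is the witness, and the identity theorem makes the chosen function equal to
  it.\<close>

lemma analytic_continuation_eq:
  assumes "open S" "connected S" "open U" "U \<noteq> {}" "U \<subseteq> S"
    and g: "g holomorphic_on S" "\<And>z. z \<in> U \<Longrightarrow> g z = f z" and z: "z \<in> S"
  shows "Defs.analytic_continuation S U f z = g z"
proof -
  define k where "k = Defs.analytic_continuation S U f"
  have "k holomorphic_on S \<and> (\<forall>z\<in>U. k z = f z)"
    unfolding k_def analytic_continuation_def by (rule someI[of _ g]) (use g in auto)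
  then have "k z = g z"
    using assms by (intro analytic_continuation_open[of U S k g z]) auto
  then show ?thesis by (simp add: k_def)
qed

text \<open>The reflection exchanges the two cuts, so connectedness carries over from
  \<open>hyp_plane\<close>.\<close>

lemma cut_plane_eq: "cut_plane = (\<lambda>x. 2 - x) ` hyp_plane"
proof (intro equalityI subsetI)
  fix z assume z: "z \<in> cut_plane"
  have "2 - z \<in> hyp_plane"
  proof (rule ccontr)
    assume "2 - z \<notin> hyp_plane"
    then obtain r where "2 - z = of_real r" "r \<ge> 1" by (auto simp: hyp_plane_def)
    then have "z = of_real (2 - r)" "2 - r \<in> {..1}" by (auto simp: algebra_simps)
    then show False using z unfolding cut_plane_def by blast
  qed
  then show "z \<in> (\<lambda>x. 2 - x) ` hyp_plane" by (rule rev_image_eqI) simp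
next
  fix z assume "z \<in> (\<lambda>x. 2 - x) ` hyp_plane"
  then obtain x where x: "x \<in> hyp_plane" "z = 2 - x" by blast
  show "z \<in> cut_plane"
  proof (rule ccontr)
    assume "z \<notin> cut_plane"
    then obtain r where "z = of_real r" "r \<le> 1" by (auto simp: cut_plane_def)
    then have "x = of_real (2 - r)" "2 - r \<in> {1..}" using x by (auto simp: algebra_simps)
    then show False using x unfolding hyp_plane_def by blast
  qed
qed

lemma open_cut_plane: "open cut_plane"
  unfolding cut_plane_def by (intro open_Compl closed_slot_left)

lemma connected_cut_plane: "connected cut_plane"
  unfolding cut_plane_eq by (intro connected_continuous_image continuous_intros connected_hyp_plane)

lemma cut_plane_not_nonpos: "z \<in> cut_plane \<Longrightarrow> z \<notin> \<real>\<^sub>\<le>\<^sub>0"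
  by (auto simp: cut_plane_def elim!: nonpos_Reals_cases)

lemma inverse_square_notin_hyp_plane:
  assumes "z \<noteq> 0" "1 / z\<^sup>2 \<notin> hyp_plane"
  shows "z \<in> complex_of_real ` {-1..1}"
proof -
  obtain r where r: "1 / z\<^sup>2 = of_real r" "r \<ge> 1" using assms by (auto simp: hyp_plane_def)
  have "z\<^sup>2 = of_real (1 / sqrt r) ^ 2"
    using r assms by (simp add: field_simps flip: of_real_power)
  then have "z = of_real (1 / sqrt r) \<or> z = of_real (- (1 / sqrt r))" by (simp only: power2_eq_iff of_real_minus)
  moreover have "1 / sqrt r \<in> {-1..1}" "- (1 / sqrt r) \<in> {-1..1}"
    using r(2) by (auto simp: divide_le_eq_1 intro: order_trans[of _ 0])
  ultimately show ?thesis by blast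
qed

lemma inverse_square_in_hyp_plane:
  assumes "z \<in> cut_plane"
  shows "1 / z\<^sup>2 \<in> hyp_plane"
  using inverse_square_notin_hyp_plane[of z] assms cut_plane_not_real(1)[OF assms] by (force simp: cut_plane_def)

text \<open>Both sides have the same square, so only a sign is in question. The square of
  \<open>\<sigma>\<close> avoids the nonpositive reals, hence \<open>Re (\<sigma> z)\<close> has no
  zero on the connected cut plane and keeps its sign at \<open>z = 2\<close>. This ties the branch
  in \<open>sqrt_prod\<close> to the principal root \<open>p\<close>.\<close>

lemma exp_half_ln_sq_minus_1:
  assumes z: "z \<in> cut_plane"
  shows "exp (ln_sq_minus_1 z / 2) = z * csqrt (1 - 1 / z\<^sup>2)"
proof -
  define \<sigma> where "\<sigma> = (\<lambda>z. exp (ln_sq_minus_1 z / 2) / z)"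
  have sq: "(\<sigma> z)\<^sup>2 = 1 - 1 / z\<^sup>2" if "z \<in> cut_plane" for z
  proof -
    have "(\<sigma> z)\<^sup>2 = exp (ln_sq_minus_1 z) / z\<^sup>2"
      by (simp add: \<sigma>_def power_divide flip: exp_double)
    then show ?thesis using that cut_plane_not_real(1)[OF that] by (simp add: exp_ln_sq_minus_1 diff_divide_distrib)
  qed
  have nz: "Re (\<sigma> z) \<noteq> 0" if "z \<in> cut_plane" for z
  proof
    assume "Re (\<sigma> z) = 0"
    then have "(\<sigma> z)\<^sup>2 \<in> \<real>\<^sub>\<le>\<^sub>0" by (simp add: complex_nonpos_Reals_iff power2_eq_square)
    then show False using inverse_square_in_hyp_plane[OF that] unfolding sq[OF that] in_hyp_plane_iff by simp
  qed
  have notin: "z - 1 \<notin> \<real>\<^sub>\<le>\<^sub>0 \<and> z + 1 \<notin> \<real>\<^sub>\<le>\<^sub>0 \<and> z \<noteq> 0" if z: "z \<in> cut_plane" for z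
  proof -
    have "z - of_real a \<notin> \<real>\<^sub>\<le>\<^sub>0" if "a \<le> 1" for a
    proof
      assume "z - of_real a \<in> \<real>\<^sub>\<le>\<^sub>0"
      then obtain r where "z - of_real a = of_real r" "r \<le> 0" by (auto elim!: nonpos_Reals_cases)
      then have "z = of_real (r + a)" "r + a \<in> {..1}" using that by (auto simp: algebra_simps)
      then show False using z unfolding cut_plane_def by blast
    qed
    from this[of 1] this[of "-1"] show ?thesis using cut_plane_not_real(1)[OF z] by simp
  qed
  have "continuous_on cut_plane (\<lambda>z. Re (\<sigma> z))"
    unfolding \<sigma>_def ln_sq_minus_1_def by (intro continuous_intros) (use notin in auto)
  then have conn: "connected ((\<lambda>z. Re (\<sigma> z)) ` cut_plane)"
    by (rule connected_continuous_image[OF _ connected_cut_plane])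
  have two: "(2::complex) \<in> cut_plane"
    by (auto simp: cut_plane_def complex_eq_iff)
  have pos2: "Re (\<sigma> 2) > 0"
  proof -
    have "\<sigma> 2 = of_real (exp (ln 3 / 2) / 2)"
      using Ln_of_real[of 3] by (simp add: \<sigma>_def ln_sq_minus_1_def flip: exp_of_real)
    then show ?thesis by (simp only: Re_complex_of_real) simp
  qed
  have "Re (\<sigma> z) > 0"
  proof (rule ccontr)
    assume "\<not> Re (\<sigma> z) > 0"
    then have "{Re (\<sigma> z)..Re (\<sigma> 2)} \<subseteq> (\<lambda>z. Re (\<sigma> z)) ` cut_plane"
      using connected_contains_Icc[OF conn] z two by blast
    moreover have "0 \<in> {Re (\<sigma> z)..Re (\<sigma> 2)}" using \<open>\<not> Re (\<sigma> z) > 0\<close> pos2 by auto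
    ultimately show False using nz by force
  qed
  then have "csqrt (1 - 1 / z\<^sup>2) = \<sigma> z" using sq[OF z] by (intro csqrt_unique) auto
  then show ?thesis using notin[OF z] by (simp add: \<sigma>_def)
qed

section \<open>The logarithmic variable\<close>

definition log_domain :: "complex set" where
  "log_domain = {w. exp w \<notin> complex_of_real ` {-1..1}}"

text \<open>With \<open>z = exp w\<close>, the argument \<open>1 / z^2\<close> of F is
  \<open>exp (- 2 * w)\<close>, so this domain is exactly where F can be evaluated.\<close>

lemma log_domain_iff: "w \<in> log_domain \<longleftrightarrow> exp (- 2 * w) \<in> hyp_plane"
proof -
  have e: "exp (- 2 * w) = 1 / (exp w)\<^sup>2"
    by (simp add: exp_minus exp_double inverse_eq_divide)
  have "1 / (exp w)\<^sup>2 \<notin> hyp_plane" if w: "exp w = complex_of_real r" "r \<in> {-1..1}" for r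
  proof -
    have r0: "r \<noteq> 0" using w(1) by auto
    have "r\<^sup>2 \<le> 1" using w(2) by (auto simp: abs_square_le_1 abs_le_iff)
    then have "1 / r\<^sup>2 \<in> {1..}" using r0 by (simp add: le_divide_eq)
    moreover have "1 / (exp w)\<^sup>2 = complex_of_real (1 / r\<^sup>2)" by (simp add: w)
    ultimately show ?thesis unfolding hyp_plane_def by blast
  qed
  then show ?thesis using inverse_square_notin_hyp_plane[of "exp w"] unfolding e log_domain_def by auto
qed

lemma open_log_domain: "open log_domain"
proof -
  have "log_domain = (\<lambda>w. exp (- 2 * w)) -` hyp_plane" using log_domain_iff by blast
  moreover have "open ((\<lambda>w. exp (- 2 * w)) -` hyp_plane)"
    by (intro open_vimage open_hyp_plane continuous_intros)
  ultimately show ?thesis by metis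
qed

text \<open>Moving \<open>w\<close> to the right multiplies \<open>exp w\<close> by a real factor at
  least 1, which cannot lead into the interval \<open>{-1..1}\<close>. A horizontal segment
  therefore joins each point to the half-plane \<open>H\<close>.\<close>

lemma connected_log_domain: "connected log_domain"
proof -
  define H where "H = {w::complex. Re w > 0}"
  have H: "H \<subseteq> log_domain"
  proof
    fix w assume "w \<in> H"
    then have "norm (exp (- 2 * w)) < 1" by (simp add: H_def norm_exp_eq_Re)
    then show "w \<in> log_domain" using ball_subset_hyp_plane unfolding log_domain_iff by auto
  qed
  define A where "A = (\<lambda>w::complex. closed_segment w (w + of_real (1 + \<bar>Re w\<bar>)) \<union> H)"
  have sub: "A w \<subseteq> log_domain" if w: "w \<in> log_domain" for w
  proof -
    have "y \<in> log_domain" if y: "y \<in> closed_segment w (w + of_real (1 + \<bar>Re w\<bar>))" for y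
    proof (rule ccontr)
      obtain u where u: "0 \<le> u" "y = w + of_real u"
      proof -
        obtain v where "0 \<le> v" "v \<le> 1" "y = (1 - v) *\<^sub>R w + v *\<^sub>R (w + of_real (1 + \<bar>Re w\<bar>))"
          using y by (auto simp: in_segment)
        then have "y = w + of_real (v * (1 + \<bar>Re w\<bar>))" "0 \<le> v * (1 + \<bar>Re w\<bar>)"
          by (auto simp: scaleR_conv_of_real algebra_simps)
        then show thesis using that by blast
      qed
      assume "y \<notin> log_domain"
      then obtain r where r: "exp y = complex_of_real r" "r \<in> {-1..1}" by (auto simp: log_domain_def)
      have "exp w = complex_of_real (r * exp (- u))"
        using r(1) u by (simp add: exp_add exp_minus field_simps flip: exp_of_real)
      moreover have "r * exp (- u) \<in> {-1..1}"
      proof -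
        have "\<bar>r * exp (- u)\<bar> \<le> 1 * 1" unfolding abs_mult using r u by (intro mult_mono) auto
        then show ?thesis by (simp add: abs_le_iff)
      qed
      ultimately show False using w unfolding log_domain_def by blast
    qed
    then show ?thesis using H by (auto simp: A_def)
  qed
  have eq: "log_domain = \<Union> (A ` log_domain)"
    using sub by (auto simp: A_def)
  have "connected (\<Union> (A ` log_domain))"
  proof (rule connected_Union)
    have "(1::complex) \<in> H" by (simp add: H_def)
    then show "\<Inter> (A ` log_domain) \<noteq> {}" by (auto simp: A_def)
    fix B assume "B \<in> A ` log_domain"
    then obtain w where B: "B = A w" by blast
    have "w + of_real (1 + \<bar>Re w\<bar>) \<in> closed_segment w (w + of_real (1 + \<bar>Re w\<bar>)) \<inter> H"
      by (auto simp: H_def)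
    then have "connected (closed_segment w (w + of_real (1 + \<bar>Re w\<bar>)) \<union> H)"
      by (intro connected_Un connected_segment) (auto simp: H_def intro!: convex_connected convex_halfspace_Re_gt)
    then show "connected B" by (simp add: B A_def)
  qed
  then show ?thesis using eq by simp
qed

section \<open>Closed forms on both domains and the contour integral\<close>

context
  fixes lam \<alpha> :: complex
  assumes re_alpha: "Re \<alpha> > 0" and re_lam: "Re lam > -1"
begin

text \<open>The prefactor of the Gauss series divided by the normalization
  \<open>2 powr (- lam - 1) * Gamma (lam + 1) * Gamma \<alpha>\<close> of \<open>hyp_cont\<close>;
  the powers of 2 combine to
  \<open>- (lam + 2 * \<alpha>) + (lam + 1) = 1 - 2 * \<alpha>\<close>.\<close>

definition D_const :: complex where
  "D_const = exp (\<i> * of_real pi * \<alpha>) * Gamma (lam + 2 * \<alpha>) * 2 powr (1 - 2 * \<alpha>) / (Gamma (lam + 1) * (Gamma \<alpha>)\<^sup>2)"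

lemma Gamma_nonzeros: "Gamma (lam + 1) \<noteq> 0" "Gamma \<alpha> \<noteq> 0" "Gamma (lam + \<alpha> + 1) \<noteq> 0"
proof -
  have nz: "z \<notin> \<int>\<^sub>\<le>\<^sub>0" if "Re z > 0" for z :: complex using that by (auto elim!: nonpos_Ints_cases)
  show "Gamma (lam + 1) \<noteq> 0" "Gamma \<alpha> \<noteq> 0" "Gamma (lam + \<alpha> + 1) \<noteq> 0"
    using re_alpha re_lam nz by (auto simp: Gamma_eq_zero_iff)
qed

lemma gegenbauer_D_series_eq:
  assumes z: "z \<in> cut_plane" "norm z > 1"
  shows "gegenbauer_D_series lam \<alpha> z = D_const * exp (- (lam + 2 * \<alpha>) * Ln z) * hyp_cont lam \<alpha> (1 / z\<^sup>2)"
proof -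
  have z0: "z \<noteq> 0" using cut_plane_not_real(1)[OF z(1)] .
  have n: "norm (1 / z\<^sup>2) < 1"
    using z by (simp add: norm_divide norm_power divide_less_eq one_less_power)
  have ser: "rGamma (lam + \<alpha> + 1) * hyp_cont lam \<alpha> (1 / z\<^sup>2) = hyp_cont lam \<alpha> 0 *
      reg_hyp2F1 (lam / 2 + \<alpha>) (lam / 2 + \<alpha> + 1 / 2) (lam + \<alpha> + 1) (1 / z\<^sup>2)"
    by (rule hyp_cont_series[OF re_alpha re_lam n])
  have F0: "hyp_cont lam \<alpha> 0 = 2 powr (- lam - 1) * (Gamma (lam + 1) * Gamma \<alpha> * rGamma (lam + \<alpha> + 1))"
    using hyp_cont_0[OF re_alpha re_lam] by (simp add: Beta_altdef algebra_simps)
  have rG: "rGamma (lam + \<alpha> + 1) \<noteq> 0" using c_notin[OF re_alpha re_lam] by (simp add: rGamma_eq_zero_iff)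
  \<comment> \<open>The reciprocal Gamma factor of the Beta function cancels the one in
    \<open>ser\<close>, which leaves the regularized series without it.\<close>
  have "hyp_cont lam \<alpha> (1 / z\<^sup>2) = 2 powr (- lam - 1) * (Gamma (lam + 1) * Gamma \<alpha>) *
      reg_hyp2F1 (lam / 2 + \<alpha>) (lam / 2 + \<alpha> + 1 / 2) (lam + \<alpha> + 1) (1 / z\<^sup>2)"
    using ser rG unfolding F0 by simp
  then have H: "reg_hyp2F1 (lam / 2 + \<alpha>) (lam / 2 + \<alpha> + 1 / 2) (lam + \<alpha> + 1) (1 / z\<^sup>2) =
      hyp_cont lam \<alpha> (1 / z\<^sup>2) / (2 powr (- lam - 1) * (Gamma (lam + 1) * Gamma \<alpha>))"
    using Gamma_nonzeros by simp
  have P: "(2 * z) powr (lam + 2 * \<alpha>) = 2 powr (lam + 2 * \<alpha>) * exp ((lam + 2 * \<alpha>) * Ln z)"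
    using Ln_times_of_real[of 2 z] Ln_of_real[of 2] z0 by (simp add: powr_def algebra_simps exp_add)
  have E: "exp (- (lam + 2 * \<alpha>) * Ln z) = 1 / exp ((lam + 2 * \<alpha>) * Ln z)"
    unfolding mult_minus_left exp_minus inverse_eq_divide ..
  have Q: "2 powr (lam + 2 * \<alpha>) * 2 powr (- lam - 1) * 2 powr (1 - 2 * \<alpha>) = (1 :: complex)"
    by (simp flip: powr_add)
  have gen: "x / (g * (u * e)) * (F / (v * (l * g))) = x * w / (l * g\<^sup>2) * (1 / e) * F"
    if "u * v * w = 1" "g \<noteq> 0" "e \<noteq> 0" "l \<noteq> 0" for x g u e F v l w :: complex
  proof -
    have "u \<noteq> 0" "v \<noteq> 0" using that(1) by auto
    then have "w = 1 / (u * v)" using that(1) by (simp add: field_simps)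
    then show ?thesis using that \<open>u \<noteq> 0\<close> \<open>v \<noteq> 0\<close> by (simp add: power2_eq_square)
  qed
  show ?thesis
    unfolding gegenbauer_D_series_def H P E D_const_def
    by (rule gen[OF Q Gamma_nonzeros(2) exp_not_eq_zero Gamma_nonzeros(1)])
qed

lemma gegenbauer_D_eq:
  assumes z: "z \<in> cut_plane"
  shows "gegenbauer_D lam \<alpha> z = D_const * exp (- (lam + 2 * \<alpha>) * Ln z) * hyp_cont lam \<alpha> (1 / z\<^sup>2)"
  unfolding gegenbauer_D_def
proof (rule analytic_continuation_eq[OF open_cut_plane connected_cut_plane _ _ _ _ _ z])
  have "{z \<in> cut_plane. norm z > 1} = cut_plane \<inter> {z. norm z > 1}" by auto
  then show "open {z \<in> cut_plane. norm z > 1}"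
    using open_cut_plane by (auto intro!: open_Int open_Collect_less continuous_intros)
  have "(2::complex) \<in> {z \<in> cut_plane. norm z > 1}"
    by (auto simp: cut_plane_def complex_eq_iff)
  then show "{z \<in> cut_plane. norm z > 1} \<noteq> {}" by blast
  show "(\<lambda>z. D_const * exp (- (lam + 2 * \<alpha>) * Ln z) * hyp_cont lam \<alpha> (1 / z\<^sup>2)) holomorphic_on cut_plane"
    by (intro holomorphic_intros holomorphic_on_compose_gen[OF _ hyp_cont_ode(1)[OF re_alpha re_lam], unfolded o_def])
       (use cut_plane_not_nonpos cut_plane_not_real(1) inverse_square_in_hyp_plane in auto)
qed (use gegenbauer_D_series_eq in auto)

text \<open>F depends on \<open>z\<close> only through \<open>z^2\<close> and needs no choice of
  sheet. All multivaluedness sits in the power of \<open>z\<close>, which is an entire function of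
  \<open>w\<close>.\<close>

lemma gegenbauer_D_log_eq:
  assumes w: "w \<in> log_domain"
  shows "gegenbauer_D_log lam \<alpha> w = D_const * exp (- (lam + 2 * \<alpha>) * w) * hyp_cont lam \<alpha> (exp (- 2 * w))"
  unfolding gegenbauer_D_log_def log_domain_def[symmetric]
proof (rule analytic_continuation_eq[OF open_log_domain connected_log_domain _ _ _ _ _ w])
  define U where "U = {w. \<bar>Im w\<bar> < pi \<and> exp w \<in> cut_plane}"
  have "U = {w. \<bar>Im w\<bar> < pi} \<inter> exp -` cut_plane" by (auto simp: U_def)
  then show "open U"
    by (auto intro!: open_Int open_Collect_less continuous_intros open_vimage open_cut_plane)
  have "exp 1 \<in> cut_plane"
  proof (rule ccontr)
    assume "exp 1 \<notin> cut_plane"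
    then obtain r where "exp (complex_of_real 1) = of_real r" "r \<le> 1" by (auto simp: cut_plane_def)
    then have "exp 1 \<le> (1::real)" by (simp only: exp_of_real of_real_eq_iff)
    then show False by simp
  qed
  then have "1 \<in> U" using pi_gt_zero by (simp add: U_def)
  then show "U \<noteq> {}" by blast
  show "U \<subseteq> log_domain" by (auto simp: U_def log_domain_def cut_plane_def)
  show "(\<lambda>w. D_const * exp (- (lam + 2 * \<alpha>) * w) * hyp_cont lam \<alpha> (exp (- 2 * w))) holomorphic_on log_domain"
    by (intro holomorphic_intros holomorphic_on_compose_gen[OF _ hyp_cont_ode(1)[OF re_alpha re_lam], unfolded o_def])
       (auto simp: log_domain_iff)
  fix w assume "w \<in> U"
  then have "exp w \<in> cut_plane" "Ln (exp w) = w" by (auto simp: U_def)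
  then show "D_const * exp (- (lam + 2 * \<alpha>) * w) * hyp_cont lam \<alpha> (exp (- 2 * w)) = gegenbauer_D lam \<alpha> (exp w)"
    by (simp add: gegenbauer_D_eq exp_minus exp_double inverse_eq_divide)
qed

text \<open>Since \<open>sqrt_prod z1 z2 = z1 z2 p1 p2\<close>, the contour is
  \<open>exp l * N\<close> with \<open>N = 1 + t p1 p2\<close>. The logarithm of \<open>z3\<close>
  near \<open>l\<close> is therefore \<open>l + Ln N\<close>, and every factor splits into a
  constant and a function of \<open>t\<close>.\<close>

lemma product_integrand_contour_ray:
  fixes z1 z2 :: complex
  assumes z: "z1 \<in> cut_plane" "z2 \<in> cut_plane" and t: "t > 1"
  defines "L \<equiv> ln_sq_minus_1 z1 + ln_sq_minus_1 z2" and "l \<equiv> Ln z1 + Ln z2"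
  shows "product_integrand lam \<alpha> z1 z2 (contour_ray z1 z2 t) * sqrt_prod z1 z2 =
    D_const * exp (- (lam + 2 * \<alpha>) * l) * exp ((\<alpha> - 1) * (L - l)) * 2 powr (1 - \<alpha>) * exp (L / 2) *
    (nu_kernel (lam + 2 * \<alpha>) (hyp_cont lam \<alpha>) (csqrt (1 - 1 / z2\<^sup>2)) (csqrt (1 - 1 / z1\<^sup>2)) (of_real t) * weight \<alpha> t)"
proof -
  define p1 p2 where "p1 = csqrt (1 - 1 / z1\<^sup>2)" and "p2 = csqrt (1 - 1 / z2\<^sup>2)"
  have z0: "z1 \<noteq> 0" "z2 \<noteq> 0" using z cut_plane_not_real(1) by auto
  have p: "Re p1 > 0" "Re p2 > 0"
    using z inverse_square_in_hyp_plane unfolding p1_def p2_def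
    by (auto intro!: Re_csqrt_pos simp: in_hyp_plane_iff simp del: csqrt.sel)
  define N where "N = 1 + of_real t * p1 * p2"
  have N: "N \<notin> \<real>\<^sub>\<le>\<^sub>0" using mix_not_nonpos[OF p, of 1 t] t by (simp add: N_def)
  then have N0: "N \<noteq> 0" by auto
  have s: "sqrt_prod z1 z2 = exp (L / 2)" by (simp add: sqrt_prod_def L_def)
  have s': "exp (L / 2) = z1 * z2 * (p1 * p2)"
    unfolding L_def add_divide_distrib exp_add exp_half_ln_sq_minus_1[OF z(1)] exp_half_ln_sq_minus_1[OF z(2)]
    by (simp add: p1_def p2_def)
  have el: "exp l = z1 * z2" using z0 by (simp add: l_def exp_add)
  have ray: "contour_ray z1 z2 t = exp l * N"
    by (simp add: contour_ray_def s s' el N_def algebra_simps)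
  have ln3: "ln_z3 z1 z2 (contour_ray z1 z2 t) = l + Ln N"
    unfolding ln_z3_def ln_near_def l_def[symmetric] ray by simp
  \<comment> \<open>As \<open>1 / z1^2 = 1 - p1^2\<close> and \<open>1 / z2^2 = 1 - p2^2\<close>,
    the value \<open>1 / z3^2\<close> is the kernel argument, already known to avoid the
    cut.\<close>
  have e2: "exp (- 2 * (l + Ln N)) = (1 - p1\<^sup>2) * (1 - p2\<^sup>2) / N\<^sup>2"
  proof -
    have "exp (- 2 * (l + Ln N)) = 1 / (exp l * N)\<^sup>2"
    proof -
      have "exp (- 2 * (l + Ln N)) = inverse ((exp (l + Ln N))\<^sup>2)"
        unfolding mult_minus_left exp_minus exp_double ..
      then show ?thesis using N0 by (simp add: exp_add inverse_eq_divide)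
    qed
    then show ?thesis using z0 by (simp add: el p1_def p2_def power_mult_distrib)
  qed
  have dom: "l + Ln N \<in> log_domain"
    unfolding log_domain_iff e2 unfolding N_def using p t by (intro kernel_argument_in_hyp_plane) auto
  have D: "gegenbauer_D_log lam \<alpha> (l + Ln N) =
      D_const * exp (- (lam + 2 * \<alpha>) * l) * nu_kernel (lam + 2 * \<alpha>) (hyp_cont lam \<alpha>) p2 p1 (of_real t)"
    unfolding gegenbauer_D_log_eq[OF dom] e2 nu_kernel_def N_def[symmetric]
    unfolding distrib_left exp_add by (simp only: mult.assoc)
  have pos: "(t\<^sup>2 - 1) > 0" using t by (simp add: power2_eq_square less_1_mult)
  \<comment> \<open>The power of 2 stems from the factor \<open>1/2\<close> in
    \<open>kernel_base\<close> on the contour.\<close>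
  have "exp ((\<alpha> - 1) * of_real (ln ((t\<^sup>2 - 1) / 2))) = 2 powr (1 - \<alpha>) * weight \<alpha> t"
  proof -
    have l: "ln ((t\<^sup>2 - 1) / 2) = ln (t\<^sup>2 - 1) - ln 2" using pos by (intro ln_divide_pos) auto
    have "weight \<alpha> t = exp ((\<alpha> - 1) * of_real (ln (t\<^sup>2 - 1)))"
      using pos Ln_of_real[OF pos] unfolding weight_def powr_def by (simp del: of_real_diff)
    moreover have "2 powr (1 - \<alpha>) = exp ((1 - \<alpha>) * of_real (ln 2))"
      using Ln_of_real[of 2] by (simp add: powr_def)
    ultimately show ?thesis unfolding l by (simp add: algebra_simps flip: exp_add)
  qed
  moreover have "ln_kernel_base z1 z2 (contour_ray z1 z2 t) = (L - l) + of_real (ln ((t\<^sup>2 - 1) / 2))"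
    unfolding ln_kernel_base_contour_ray[OF z t] by (simp add: L_def l_def)
  ultimately have K: "exp ((\<alpha> - 1) * ln_kernel_base z1 z2 (contour_ray z1 z2 t)) =
      exp ((\<alpha> - 1) * (L - l)) * (2 powr (1 - \<alpha>) * weight \<alpha> t)"
    by (simp only: distrib_left exp_add)
  show ?thesis
    unfolding product_integrand_def ln3 D K s p1_def[symmetric] p2_def[symmetric] by (simp only: mult_ac)
qed

lemma has_integral_product_integrand:
  fixes z1 z2 :: complex
  assumes z: "z1 \<in> cut_plane" "z2 \<in> cut_plane"
  defines "L \<equiv> ln_sq_minus_1 z1 + ln_sq_minus_1 z2" and "l \<equiv> Ln z1 + Ln z2"
  shows "((\<lambda>t. product_integrand lam \<alpha> z1 z2 (contour_ray z1 z2 t) * sqrt_prod z1 z2) has_integral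
    D_const * exp (- (lam + 2 * \<alpha>) * l) * exp ((\<alpha> - 1) * (L - l)) * 2 powr (1 - \<alpha>) * exp (L / 2) *
    (hyp_cont lam \<alpha> (1 / z1\<^sup>2) * hyp_cont lam \<alpha> (1 / z2\<^sup>2))) {1..}"
proof -
  define p1 p2 where "p1 = csqrt (1 - 1 / z1\<^sup>2)" and "p2 = csqrt (1 - 1 / z2\<^sup>2)"
  have p: "Re p1 > 0" "Re p2 > 0"
    using z inverse_square_in_hyp_plane unfolding p1_def p2_def
    by (auto intro!: Re_csqrt_pos simp: in_hyp_plane_iff simp del: csqrt.sel)
  interpret kernel_setting lam \<alpha> hyp_plane "hyp_cont lam \<alpha>" p2
    by unfold_locales
       (use re_alpha re_lam p open_hyp_plane hyp_cont_ode ball_subset_hyp_plane kernel_argument_in_hyp_plane in auto)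
  let ?g = "\<lambda>t. nu_kernel (lam + 2 * \<alpha>) (hyp_cont lam \<alpha>) p2 p1 (of_real t) * weight \<alpha> t"
  have "?g integrable_on {1<..}" using dominated p by (simp add: dominated_on_def)
  then have "(?g has_integral kernel_integral lam \<alpha> (hyp_cont lam \<alpha>) p2 p1) {1<..}"
    unfolding kernel_integral_def by (rule integrable_integral)
  then have G: "(?g has_integral hyp_cont lam \<alpha> (1 / z1\<^sup>2) * hyp_cont lam \<alpha> (1 / z2\<^sup>2)) {1<..}"
    unfolding laplace_integral_product[OF re_alpha re_lam p] by (simp add: hyp_cont_def p1_def p2_def)
  have "((\<lambda>t. product_integrand lam \<alpha> z1 z2 (contour_ray z1 z2 t) * sqrt_prod z1 z2) has_integral
    D_const * exp (- (lam + 2 * \<alpha>) * l) * exp ((\<alpha> - 1) * (L - l)) * 2 powr (1 - \<alpha>) * exp (L / 2) *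
    (hyp_cont lam \<alpha> (1 / z1\<^sup>2) * hyp_cont lam \<alpha> (1 / z2\<^sup>2))) {1<..}"
  proof (rule has_integral_eq[OF _ has_integral_mult_right[OF G]])
    fix t :: real assume "t \<in> {1<..}"
    then show "D_const * exp (- (lam + 2 * \<alpha>) * l) * exp ((\<alpha> - 1) * (L - l)) * 2 powr (1 - \<alpha>) * exp (L / 2) * ?g t =
        product_integrand lam \<alpha> z1 z2 (contour_ray z1 z2 t) * sqrt_prod z1 z2"
      unfolding L_def l_def p1_def p2_def by (intro product_integrand_contour_ray[symmetric] z) simp
  qed
  \<comment> \<open>At \<open>t = 1\<close> the kernel base is 0 and \<open>Ln 0\<close> is a
    default value; a single point does not affect the integral.\<close>
  then show ?thesis
    by (subst has_integral_spike_set_eq[of _ "{1<..}"]) (auto intro: negligible_subset[of "{1}"])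
qed

end

theorem corollary37:
  fixes z1 z2 lam \<alpha> :: complex
  assumes "z1 \<in> cut_plane" and "z2 \<in> cut_plane"
    and "lam \<noteq> 0" and "\<alpha> \<noteq> 0" and "Re (lam + 2 * \<alpha>) > 0"
    and "Re \<alpha> > 0" and "Re lam > -1"
  shows "(\<lambda>t. product_integrand lam \<alpha> z1 z2 (contour_ray z1 z2 t) * sqrt_prod z1 z2)
           integrable_on {1..} \<and>
         gegenbauer_D lam \<alpha> z1 * gegenbauer_D lam \<alpha> z2 =
           exp (\<i> * of_real pi * \<alpha>) * Gamma (lam + 2 * \<alpha>) * (z1 powr (\<alpha> - 1) * z2 powr (\<alpha> - 1)) /
           (2 powr \<alpha> * Gamma (lam + 1) * (Gamma \<alpha>)\<^sup>2 *
            exp ((\<alpha> - 1 / 2) * ln_sq_minus_1 z1) * exp ((\<alpha> - 1 / 2) * ln_sq_minus_1 z2)) *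
           integral {1..}
             (\<lambda>t. product_integrand lam \<alpha> z1 z2 (contour_ray z1 z2 t) * sqrt_prod z1 z2)"
proof
  note I = has_integral_product_integrand[OF assms(6,7,1,2)]
  show "(\<lambda>t. product_integrand lam \<alpha> z1 z2 (contour_ray z1 z2 t) * sqrt_prod z1 z2) integrable_on {1..}"
    using I by (rule has_integral_integrable)
  define Q where "Q = exp (\<i> * of_real pi * \<alpha>) * Gamma (lam + 2 * \<alpha>) / (Gamma (lam + 1) * (Gamma \<alpha>)\<^sup>2)"
  define L l F where "L = ln_sq_minus_1 z1 + ln_sq_minus_1 z2" and "l = Ln z1 + Ln z2"
    and "F = hyp_cont lam \<alpha> (1 / z1\<^sup>2) * hyp_cont lam \<alpha> (1 / z2\<^sup>2)"
  have z0: "z1 \<noteq> 0" "z2 \<noteq> 0" using assms(1,2) cut_plane_not_real(1) by auto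
  have DQ: "D_const lam \<alpha> = Q * 2 powr (1 - 2 * \<alpha>)"
    by (simp add: D_const_def[OF assms(6,7)] Q_def)
  have pz: "z1 powr (\<alpha> - 1) * z2 powr (\<alpha> - 1) = exp ((\<alpha> - 1) * l)"
    using z0 by (simp add: powr_def l_def distrib_left exp_add)
  have pre: "exp (\<i> * of_real pi * \<alpha>) * Gamma (lam + 2 * \<alpha>) * (z1 powr (\<alpha> - 1) * z2 powr (\<alpha> - 1)) /
           (2 powr \<alpha> * Gamma (lam + 1) * (Gamma \<alpha>)\<^sup>2 *
            exp ((\<alpha> - 1 / 2) * ln_sq_minus_1 z1) * exp ((\<alpha> - 1 / 2) * ln_sq_minus_1 z2)) =
        Q * 2 powr (- \<alpha>) * exp ((\<alpha> - 1) * l) * exp (- (\<alpha> - 1 / 2) * L)"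
    unfolding pz Q_def L_def distrib_left exp_add powr_minus mult_minus_left exp_minus
    by (simp add: field_simps)
  have "gegenbauer_D lam \<alpha> z1 * gegenbauer_D lam \<alpha> z2 = D_const lam \<alpha> * D_const lam \<alpha> * exp (- (lam + 2 * \<alpha>) * l) * F"
    using assms by (simp add: gegenbauer_D_eq l_def F_def distrib_left exp_add)
  \<comment> \<open>One copy of \<open>D_const\<close> is split:
    \<open>2 powr (1 - 2 * \<alpha>)\<close> is \<open>2 powr (- \<alpha>)\<close> from the
    prefactor times \<open>2 powr (1 - \<alpha>)\<close> from the integrand. The inserted
    exponentials multiply to 1, as the coefficients of \<open>l\<close> and of \<open>L\<close> in
    their exponents sum to 0.\<close>
  also have "\<dots> = Q * (2 powr (- \<alpha>) * 2 powr (1 - \<alpha>)) * D_const lam \<alpha> * exp (- (lam + 2 * \<alpha>) * l) * F *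
      (exp ((\<alpha> - 1) * l) * exp (- (\<alpha> - 1 / 2) * L) * exp ((\<alpha> - 1) * (L - l)) * exp (L / 2))"
  proof -
    have "2 powr (- \<alpha>) * 2 powr (1 - \<alpha>) = (2 :: complex) powr (1 - 2 * \<alpha>)"
      by (simp flip: powr_add)
    moreover have "exp ((\<alpha> - 1) * l) * exp (- (\<alpha> - 1 / 2) * L) * exp ((\<alpha> - 1) * (L - l)) * exp (L / 2) = 1"
      by (simp only: flip: exp_add) (simp add: algebra_simps)
    ultimately show ?thesis by (simp only: DQ mult_1_right)
  qed
  also have "\<dots> = Q * 2 powr (- \<alpha>) * exp ((\<alpha> - 1) * l) * exp (- (\<alpha> - 1 / 2) * L) *
      integral {1..} (\<lambda>t. product_integrand lam \<alpha> z1 z2 (contour_ray z1 z2 t) * sqrt_prod z1 z2)"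
    unfolding integral_unique[OF I] L_def[symmetric] l_def[symmetric] F_def[symmetric] by (simp only: mult_ac)
  finally show "gegenbauer_D lam \<alpha> z1 * gegenbauer_D lam \<alpha> z2 =
           exp (\<i> * of_real pi * \<alpha>) * Gamma (lam + 2 * \<alpha>) * (z1 powr (\<alpha> - 1) * z2 powr (\<alpha> - 1)) /
           (2 powr \<alpha> * Gamma (lam + 1) * (Gamma \<alpha>)\<^sup>2 *
            exp ((\<alpha> - 1 / 2) * ln_sq_minus_1 z1) * exp ((\<alpha> - 1 / 2) * ln_sq_minus_1 z2)) *
           integral {1..}
             (\<lambda>t. product_integrand lam \<alpha> z1 z2 (contour_ray z1 z2 t) * sqrt_prod z1 z2)"
    unfolding pre .
qed

end
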